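(* Assume the Strong Exponential Time Hypothesis (SETH). Then for no constant $c<1$ is there an algorithm that solves the Workflow Satisfiability Problem (WSP) restricted to instances in which all constraints are user-independent in time $O^*(2^{ck\log_2 k})$, where $k$ is the number of steps.
   Context: An instance of WSP is a workflow $W=(S,U,\mathcal{A},C)$: a set $S$ of $k$ steps, a set $U$ of $n$ users, authorization lists $A(s)\subseteq U$ for $s\in S$ (arbitrary), and a set $C$ of $m$ constraints, each a pair $(T,\Theta)$ with scope $T\subseteq S$ and $\Theta$ a set of functions $T\to U$; authorizations and constraints are assumed checkable in time polynomial in $n,k,m$. A plan $\pi:S\to U$ is authorized if $\pi(s)\in A(s)$ for all $s$ and eligible if $\pi|_T\in\Theta$ for all $(T,\Theta)\in C$; the question is whether an authorized eligible plan exists. A constraint $(T,\Theta)$ is user-independent if for every $\theta\in\Theta$ and every permutation $\psi:U\to U$, $\psi\circ\theta\in\Theta$. $O^*$ suppresses factors polynomial in $n,k,m$. SETH states that $\lim_{t\to\infty}\inf\{c\ge 0: t\text{-SAT on } N\text{ variables has an algorithm running in time } O(2^{cN})\}=1$. *)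

theory Defs
  imports Complex_Main "HOL-Library.FuncSet"
begin

section \<open>Workflows\<close>

record ('s, 'u) workflow =
  Steps :: "'s set"
  Users :: "'u set"
  Auth :: "'s \<Rightarrow> 'u set"
  Constraints :: "('s set \<times> ('s \<Rightarrow> 'u) set) set"

text \<open>Functions \<open>T \<rightarrow> U\<close> are extensional functions, i.e. elements of \<^term>\<open>T \<rightarrow>\<^sub>E U\<close>.\<close>

definition workflow :: "('s, 'u) workflow \<Rightarrow> bool" where
  "workflow W \<longleftrightarrow> finite (Steps W) \<and> finite (Users W) \<and> finite (Constraints W) \<and>
     (\<forall>s\<in>Steps W. Auth W s \<subseteq> Users W) \<and>
     (\<forall>(T, \<Theta>)\<in>Constraints W. T \<subseteq> Steps W \<and> \<Theta> \<subseteq> T \<rightarrow>\<^sub>E Users W)"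

definition authorized :: "('s, 'u) workflow \<Rightarrow> ('s \<Rightarrow> 'u) \<Rightarrow> bool" where
  "authorized W \<pi> \<longleftrightarrow> (\<forall>s\<in>Steps W. \<pi> s \<in> Auth W s)"

definition eligible :: "('s, 'u) workflow \<Rightarrow> ('s \<Rightarrow> 'u) \<Rightarrow> bool" where
  "eligible W \<pi> \<longleftrightarrow> (\<forall>(T, \<Theta>)\<in>Constraints W. restrict \<pi> T \<in> \<Theta>)"

definition wsp_satisfiable :: "('s, 'u) workflow \<Rightarrow> bool" where
  "wsp_satisfiable W \<longleftrightarrow> (\<exists>\<pi> \<in> Steps W \<rightarrow>\<^sub>E Users W. authorized W \<pi> \<and> eligible W \<pi>)"

definition user_independent :: "'u set \<Rightarrow> 's set \<times> ('s \<Rightarrow> 'u) set \<Rightarrow> bool" where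
  "user_independent U c \<longleftrightarrow> (case c of (T, \<Theta>) \<Rightarrow>
     \<forall>\<theta>\<in>\<Theta>. \<forall>\<psi>. bij_betw \<psi> U U \<longrightarrow> restrict (\<psi> \<circ> \<theta>) T \<in> \<Theta>)"


section \<open>Model of computation\<close>

text \<open>Algorithms are programs of the WHILE language of N. D. Jones (Computability and
  Complexity, 1997): finitely many variables hold binary trees, and the elementary operations
  cost one unit each. A step of such a program takes constantly many pointer operations on a
  word RAM, and a word RAM is simulated with a logarithmic slowdown by keeping its memory in a
  balanced tree. Hence the exponents \<open>c\<close> achievable in time \<open>O(2 ^ (c N))\<close> have the same infimum,
  and time bounds up to polynomial factors are the same, as on a RAM.\<close>

datatype tree = Leaf | Node tree tree

datatype exp = EVar nat | EConst tree | ECons exp exp | EHd exp | ETl exp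

datatype com = Skip | Assign nat exp | Seq com com | If exp com com | While exp com

type_synonym state = "nat \<Rightarrow> tree"

fun hd_tree :: "tree \<Rightarrow> tree" where
  "hd_tree Leaf = Leaf"
| "hd_tree (Node a b) = a"

fun tl_tree :: "tree \<Rightarrow> tree" where
  "tl_tree Leaf = Leaf"
| "tl_tree (Node a b) = b"

fun eval_exp :: "exp \<Rightarrow> state \<Rightarrow> tree" where
  "eval_exp (EVar x) s = s x"
| "eval_exp (EConst d) s = d"
| "eval_exp (ECons e f) s = Node (eval_exp e s) (eval_exp f s)"
| "eval_exp (EHd e) s = hd_tree (eval_exp e s)"
| "eval_exp (ETl e) s = tl_tree (eval_exp e s)"

fun exp_cost :: "exp \<Rightarrow> nat" where
  "exp_cost (EVar x) = 1"
| "exp_cost (EConst d) = 1"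
| "exp_cost (ECons e f) = 1 + exp_cost e + exp_cost f"
| "exp_cost (EHd e) = 1 + exp_cost e"
| "exp_cost (ETl e) = 1 + exp_cost e"

text \<open>\<open>exec c s t s'\<close>: program \<open>c\<close>, started in state \<open>s\<close>, halts in state \<open>s'\<close> after time \<open>t\<close>.
  The tree \<^const>\<open>Leaf\<close> stands for false, every other tree for true.\<close>

inductive exec :: "com \<Rightarrow> state \<Rightarrow> nat \<Rightarrow> state \<Rightarrow> bool" where
  exec_Skip: "exec Skip s 1 s"
| exec_Assign: "exec (Assign x e) s (1 + exp_cost e) (s(x := eval_exp e s))"
| exec_Seq: "exec c1 s t1 s1 \<Longrightarrow> exec c2 s1 t2 s2 \<Longrightarrow> exec (Seq c1 c2) s (t1 + t2) s2"
| exec_IfTrue: "eval_exp e s \<noteq> Leaf \<Longrightarrow> exec c1 s t s' \<Longrightarrow>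
    exec (If e c1 c2) s (1 + exp_cost e + t) s'"
| exec_IfFalse: "eval_exp e s = Leaf \<Longrightarrow> exec c2 s t s' \<Longrightarrow>
    exec (If e c1 c2) s (1 + exp_cost e + t) s'"
| exec_WhileTrue: "eval_exp e s \<noteq> Leaf \<Longrightarrow> exec c s t1 s1 \<Longrightarrow> exec (While e c) s1 t2 s2 \<Longrightarrow>
    exec (While e c) s (1 + exp_cost e + t1 + t2) s2"
| exec_WhileFalse: "eval_exp e s = Leaf \<Longrightarrow> exec (While e c) s (1 + exp_cost e) s"

text \<open>Input and output are in variable 0.\<close>

definition init_state :: "tree \<Rightarrow> state" where
  "init_state x = (\<lambda>_. Leaf)(0 := x)"

definition accepts :: "com \<Rightarrow> tree \<Rightarrow> bool" where
  "accepts P x \<longleftrightarrow> (\<exists>t s. exec P (init_state x) t s \<and> s 0 \<noteq> Leaf)"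

definition halts_within :: "com \<Rightarrow> tree \<Rightarrow> real \<Rightarrow> bool" where
  "halts_within P x B \<longleftrightarrow> (\<exists>t s. exec P (init_state x) t s \<and> real t \<le> B)"

definition decides_within :: "com \<Rightarrow> tree \<Rightarrow> bool \<Rightarrow> real \<Rightarrow> bool" where
  "decides_within P x b B \<longleftrightarrow> halts_within P x B \<and> (accepts P x \<longleftrightarrow> b)"


section \<open>Encodings\<close>

fun enc_list :: "tree list \<Rightarrow> tree" where
  "enc_list [] = Leaf"
| "enc_list (x # xs) = Node x (enc_list xs)"

definition enc_nat :: "nat \<Rightarrow> tree" where
  "enc_nat n = enc_list (replicate n Leaf)"

definition enc_bool :: "bool \<Rightarrow> tree" where
  "enc_bool b = (if b then Node Leaf Leaf else Leaf)"

fun enc_exp :: "exp \<Rightarrow> tree" where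
  "enc_exp (EVar x) = Node (enc_nat 0) (enc_nat x)"
| "enc_exp (EConst d) = Node (enc_nat 1) d"
| "enc_exp (ECons e f) = Node (enc_nat 2) (Node (enc_exp e) (enc_exp f))"
| "enc_exp (EHd e) = Node (enc_nat 3) (enc_exp e)"
| "enc_exp (ETl e) = Node (enc_nat 4) (enc_exp e)"

fun enc_com :: "com \<Rightarrow> tree" where
  "enc_com Skip = Node (enc_nat 0) Leaf"
| "enc_com (Assign x e) = Node (enc_nat 1) (Node (enc_nat x) (enc_exp e))"
| "enc_com (Seq c d) = Node (enc_nat 2) (Node (enc_com c) (enc_com d))"
| "enc_com (If e c d) = Node (enc_nat 3) (Node (enc_exp e) (Node (enc_com c) (enc_com d)))"
| "enc_com (While e c) = Node (enc_nat 4) (Node (enc_exp e) (enc_com c))"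


section \<open>The Strong Exponential Time Hypothesis\<close>

type_synonym literal = "nat \<times> bool"
type_synonym cnf = "literal list list"

definition cnf_satisfiable :: "cnf \<Rightarrow> bool" where
  "cnf_satisfiable \<phi> \<longleftrightarrow>
     (\<exists>\<alpha> :: nat \<Rightarrow> bool. \<forall>cl\<in>set \<phi>. \<exists>(v, b)\<in>set cl. \<alpha> v = b)"

text \<open>Clauses are not repeated, so that for fixed \<open>t\<close> the length of a formula is polynomial in
  the number \<open>N\<close> of variables and running times can be measured in terms of \<open>N\<close> alone.\<close>

definition is_tcnf :: "nat \<Rightarrow> nat \<Rightarrow> cnf \<Rightarrow> bool" where
  "is_tcnf t N \<phi> \<longleftrightarrow> distinct \<phi> \<and>
     (\<forall>cl\<in>set \<phi>. length cl \<le> t \<and> (\<forall>(v, b)\<in>set cl. v < N))"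

definition enc_literal :: "literal \<Rightarrow> tree" where
  "enc_literal l = Node (enc_nat (fst l)) (enc_bool (snd l))"

definition enc_cnf :: "nat \<Rightarrow> cnf \<Rightarrow> tree" where
  "enc_cnf N \<phi> = Node (enc_nat N) (enc_list (map (enc_list \<circ> map enc_literal) \<phi>))"

definition tsat_solvable :: "nat \<Rightarrow> real \<Rightarrow> bool" where
  "tsat_solvable t c \<longleftrightarrow> (\<exists>P K. \<forall>N \<phi>. is_tcnf t N \<phi> \<longrightarrow>
     decides_within P (enc_cnf N \<phi>) (cnf_satisfiable \<phi>) (K * 2 powr (c * real N)))"

definition SETH :: bool where
  "SETH \<longleftrightarrow> (\<lambda>t. Inf {c. c \<ge> 0 \<and> tsat_solvable t c}) \<longlonglongrightarrow> 1"


section \<open>Workflow instances as inputs of algorithms\<close>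

text \<open>Steps and users are numbered. A constraint is given by a list of the steps in its scope
  and a program that decides which functions from the scope to the users belong to it.\<close>

record wsp_input =
  num_steps :: nat
  num_users :: nat
  auth_lists :: "nat list list"
  checkers :: "(nat list \<times> com) list"

definition enc_assignment :: "nat list \<Rightarrow> (nat \<Rightarrow> nat) \<Rightarrow> tree" where
  "enc_assignment ss \<theta> = enc_list (map (enc_nat \<circ> \<theta>) ss)"

definition constraint_of :: "nat \<Rightarrow> nat list \<times> com \<Rightarrow> nat set \<times> (nat \<Rightarrow> nat) set" where
  "constraint_of n c = (case c of (ss, P) \<Rightarrow>
     (set ss, {\<theta> \<in> set ss \<rightarrow>\<^sub>E {..<n}. accepts P (enc_assignment ss \<theta>)}))"

definition workflow_of :: "wsp_input \<Rightarrow> (nat, nat) workflow" where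
  "workflow_of I = \<lparr>
     Steps = {..<num_steps I},
     Users = {..<num_users I},
     Auth = (\<lambda>s. set (auth_lists I ! s)),
     Constraints = constraint_of (num_users I) ` set (checkers I)\<rparr>"

definition enc_input :: "wsp_input \<Rightarrow> tree" where
  "enc_input I = enc_list
     [enc_nat (num_steps I),
      enc_nat (num_users I),
      enc_list (map (enc_list \<circ> map enc_nat) (auth_lists I)),
      enc_list (map (\<lambda>(ss, P). Node (enc_list (map enc_nat ss)) (enc_com P)) (checkers I))]"

text \<open>Every polynomial in \<open>n\<close>, \<open>k\<close>, \<open>m\<close> is dominated by \<open>poly_bound d\<close> for some \<open>d\<close>.\<close>

definition poly_bound :: "nat \<Rightarrow> wsp_input \<Rightarrow> nat" where
  "poly_bound d I = d * (num_users I + num_steps I + length (checkers I) + 1) ^ d"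

text \<open>Checkability in polynomial time comprises a polynomial bound on the length of the
  description: otherwise a checker could contain a table of all functions on its scope,
  of which it reads a single entry per query.\<close>

definition poly_checkable :: "nat \<Rightarrow> wsp_input \<Rightarrow> bool" where
  "poly_checkable d I \<longleftrightarrow> size (enc_input I) \<le> poly_bound d I \<and>
     (\<forall>(ss, P)\<in>set (checkers I). \<forall>\<theta> \<in> set ss \<rightarrow>\<^sub>E {..<num_users I}.
        halts_within P (enc_assignment ss \<theta>) (real (poly_bound d I)))"

definition valid_input :: "wsp_input \<Rightarrow> bool" where
  "valid_input I \<longleftrightarrow> length (auth_lists I) = num_steps I \<and> workflow (workflow_of I)"

text \<open>Algorithm \<open>A\<close> solves the problem on all instances with user-independent constraints in
  time \<open>O*(f k)\<close>: whatever polynomial \<open>poly_bound d\<close> bounds the time for checking constraints,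
  the running time is at most \<open>f k\<close> times some polynomial in \<open>n\<close>, \<open>k\<close>, \<open>m\<close>.\<close>

definition solves_ui_wsp_in_Ostar :: "com \<Rightarrow> (nat \<Rightarrow> real) \<Rightarrow> bool" where
  "solves_ui_wsp_in_Ostar A f \<longleftrightarrow> (\<forall>d. \<exists>e. \<forall>I.
     valid_input I \<and> poly_checkable d I \<and>
     (\<forall>c\<in>Constraints (workflow_of I). user_independent (Users (workflow_of I)) c) \<longrightarrow>
     decides_within A (enc_input I) (wsp_satisfiable (workflow_of I))
       (real (poly_bound e I) * f (num_steps I)))"

end

theory Submission
  imports Defs "HOL-Real_Asymp.Real_Asymp"
begin

text \<open>An algorithm for the workflow problem with exponent \<open>c < 1\<close> yields, for every \<open>t\<close>, an
  algorithm for \<open>t\<close>-SAT with an exponent \<open>c' < 1\<close> that does not depend on \<open>t\<close>. The \<open>N\<close> variables are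
  split into blocks of \<open>b\<close> variables, where \<open>b\<close> is maximal with \<open>2 ^ b * b\<^sup>2 \<le> N\<close>. There are \<open>2 ^ b\<close>
  users, one anchor step per user, for which only this user is authorized, and one step per block,
  for which everybody is authorized and whose user encodes the values of the variables of the block.
  The anchors make users distinguishable by user-independent constraints: a clause becomes a
  disjunction of equations between the user of a block and the user of an anchor. The number \<open>k\<close> of
  steps is \<open>N / b * (1 + o(1))\<close> and \<open>log 2 k \<le> b * (1 + o(1))\<close>, so \<open>k * log 2 k \<le> N * (1 + o(1))\<close>.

  The list of a scope may repeat steps. Listing the two sides of each equation one after the
  other, all constraints share one checker, which looks for a pair of equal neighbours.\<close>


section \<open>Execution of programs\<close>

fun exp_vars :: "exp \<Rightarrow> nat set" where
  "exp_vars (EVar x) = {x}"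
| "exp_vars (EConst d) = {}"
| "exp_vars (ECons e f) = exp_vars e \<union> exp_vars f"
| "exp_vars (EHd e) = exp_vars e"
| "exp_vars (ETl e) = exp_vars e"

fun com_vars :: "com \<Rightarrow> nat set" where
  "com_vars Skip = {}"
| "com_vars (Assign x e) = insert x (exp_vars e)"
| "com_vars (Seq c d) = com_vars c \<union> com_vars d"
| "com_vars (If e c d) = exp_vars e \<union> com_vars c \<union> com_vars d"
| "com_vars (While e c) = exp_vars e \<union> com_vars c"

lemma finite_exp_vars: "finite (exp_vars e)"
  by (induction e) auto

lemma finite_com_vars: "finite (com_vars c)"
  by (induction c) (auto simp: finite_exp_vars)

lemma eval_exp_cong: "(\<And>x. x \<in> exp_vars e \<Longrightarrow> s x = s' x) \<Longrightarrow> eval_exp e s = eval_exp e s'"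
  by (induction e) auto

text \<open>\<open>accepts\<close> asks for some halting run; uniqueness makes any exhibited run
  decisive, as \<open>decides_within_Seq\<close> and \<open>obtain_checker\<close> require.\<close>

lemma exec_deterministic:
  "exec c s t s' \<Longrightarrow> exec c s u s'' \<Longrightarrow> t = u \<and> s' = s''"
proof (induction arbitrary: u s'' rule: exec.induct)
  case (exec_Skip s)
  then show ?case by (cases rule: exec.cases) auto
next
  case (exec_Assign x e s)
  then show ?case by (cases rule: exec.cases) auto
next
  case (exec_Seq c1 s t1 s1 c2 t2 s2)
  from exec_Seq.prems show ?case
    by (cases rule: exec.cases) (auto dest!: exec_Seq.IH)
next
  case (exec_IfTrue e s c1 t s' c2)
  from exec_IfTrue.prems show ?case
    by (cases rule: exec.cases) (auto dest!: exec_IfTrue.IH simp: exec_IfTrue.hyps)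
next
  case (exec_IfFalse e s c2 t s' c1)
  from exec_IfFalse.prems show ?case
    by (cases rule: exec.cases) (auto dest!: exec_IfFalse.IH simp: exec_IfFalse.hyps)
next
  case (exec_WhileTrue e s c t1 s1 t2 s2)
  from exec_WhileTrue.prems show ?case
    by (cases rule: exec.cases) (auto dest!: exec_WhileTrue.IH simp: exec_WhileTrue.hyps)
next
  case (exec_WhileFalse e s c)
  from exec_WhileFalse.prems show ?case
    by (cases rule: exec.cases) (auto simp: exec_WhileFalse.hyps)
qed

text \<open>Variables outside \<open>V\<close> are neither read nor written, so a subroutine has the
  same effect and running time while its caller stores data there.\<close>

lemma exec_frame:
  assumes "exec c s t s'" "com_vars c \<subseteq> V" "\<And>x. x \<in> V \<Longrightarrow> s x = r x"
  shows "exec c r t (\<lambda>x. if x \<in> V then s' x else r x)"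
  using assms
proof (induction arbitrary: r rule: exec.induct)
  case (exec_Skip s)
  then have "(\<lambda>x. if x \<in> V then s x else r x) = r" by auto
  then show ?case using exec.exec_Skip by simp
next
  case (exec_Assign x e s)
  have "eval_exp e s = eval_exp e r"
    using exec_Assign by (intro eval_exp_cong) auto
  then have "(\<lambda>y. if y \<in> V then (s(x := eval_exp e s)) y else r y) = r(x := eval_exp e r)"
    using exec_Assign by auto
  then show ?case using exec.exec_Assign by simp
next
  case (exec_Seq c1 s t1 s1 c2 t2 s2)
  let ?r1 = "\<lambda>x. if x \<in> V then s1 x else r x"
  have "exec c1 r t1 ?r1" using exec_Seq by simp
  moreover have "exec c2 ?r1 t2 (\<lambda>x. if x \<in> V then s2 x else ?r1 x)"
    using exec_Seq by simp
  moreover have "(\<lambda>x. if x \<in> V then s2 x else ?r1 x) = (\<lambda>x. if x \<in> V then s2 x else r x)"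
    by auto
  ultimately show ?case using exec.exec_Seq by metis
next
  case (exec_IfTrue e s c1 t s' c2)
  have "eval_exp e s = eval_exp e r"
    using exec_IfTrue.prems by (intro eval_exp_cong) auto
  then show ?case using exec_IfTrue by (intro exec.exec_IfTrue) auto
next
  case (exec_IfFalse e s c2 t s' c1)
  have "eval_exp e s = eval_exp e r"
    using exec_IfFalse.prems by (intro eval_exp_cong) auto
  then show ?case using exec_IfFalse by (intro exec.exec_IfFalse) auto
next
  case (exec_WhileTrue e s c t1 s1 t2 s2)
  let ?r1 = "\<lambda>x. if x \<in> V then s1 x else r x"
  have e: "eval_exp e s = eval_exp e r"
    using exec_WhileTrue.prems by (intro eval_exp_cong) auto
  have "exec c r t1 ?r1" using exec_WhileTrue by simp
  moreover have "exec (While e c) ?r1 t2 (\<lambda>x. if x \<in> V then s2 x else ?r1 x)"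
    using exec_WhileTrue by simp
  moreover have "(\<lambda>x. if x \<in> V then s2 x else ?r1 x) = (\<lambda>x. if x \<in> V then s2 x else r x)"
    by auto
  ultimately show ?case using exec.exec_WhileTrue[of e r c] exec_WhileTrue.hyps e by metis
next
  case (exec_WhileFalse e s c)
  have "eval_exp e s = eval_exp e r"
    using exec_WhileFalse.prems by (intro eval_exp_cong) auto
  moreover have "(\<lambda>x. if x \<in> V then s x else r x) = r" using exec_WhileFalse by auto
  ultimately show ?case using exec.exec_WhileFalse[of e r c] exec_WhileFalse.hyps by simp
qed

text \<open>Variables below \<open>m\<close> belong to a subroutine, the three from \<open>m\<close> on to its caller.\<close>

definition frame :: "nat \<Rightarrow> tree \<Rightarrow> tree \<Rightarrow> tree \<Rightarrow> tree \<Rightarrow> state" where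
  "frame m x a b c = (init_state x)(m := a, m + 1 := b, m + 2 := c)"

lemma frame_apply:
  assumes "0 < m"
  shows "frame m x a b c 0 = x" "frame m x a b c m = a"
    "frame m x a b c (Suc m) = b" "frame m x a b c (Suc (Suc m)) = c"
  using assms by (auto simp: frame_def init_state_def)

lemma frame_update:
  assumes "0 < m"
  shows "(frame m x a b c)(0 := y) = frame m y a b c"
    "(frame m x a b c)(m := y) = frame m x y b c"
    "(frame m x a b c)(Suc m := y) = frame m x a y c"
    "(frame m x a b c)(Suc (Suc m) := y) = frame m x a b y"
  using assms by (auto simp: frame_def init_state_def fun_eq_iff)

lemma init_state_eq_frame: "0 < m \<Longrightarrow> init_state x = frame m x Leaf Leaf Leaf"
  by (auto simp: frame_def init_state_def fun_eq_iff)

text \<open>Ending in \<open>init_state y\<close> means that the subroutine leaves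
  \<open>Leaf\<close> in all its variables but 0. Hence only variable 0 changes in the frame, and
  the subroutine can be called again.\<close>

lemma exec_in_frame:
  assumes "exec P (init_state x) t (init_state y)" "com_vars P \<subseteq> {..<m}" "0 < m"
  shows "exec P (frame m x a b c) t (frame m y a b c)"
proof -
  have "exec P (frame m x a b c) t (\<lambda>v. if v \<in> {..<m} then init_state y v else frame m x a b c v)"
    by (rule exec_frame[OF assms(1,2)]) (auto simp: frame_def)
  moreover have "(\<lambda>v. if v \<in> {..<m} then init_state y v else frame m x a b c v) = frame m y a b c"
    using assms(3) by (auto simp: frame_def init_state_def fun_eq_iff)
  ultimately show ?thesis by simp
qed

lemma exec_AssignI:
  "s' = s(x := eval_exp e s) \<Longrightarrow> t = 1 + exp_cost e \<Longrightarrow> exec (Assign x e) s t s'"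
  using exec_Assign by simp

lemma exec_withinI: "exec c s t s' \<Longrightarrow> t \<le> B \<Longrightarrow> \<exists>t \<le> B. exec c s t s'"
  by blast

lemma obtain_var_bound:
  obtains m where "0 < m" "com_vars P \<subseteq> {..<m}" "com_vars Q \<subseteq> {..<m}"
proof -
  have "finite (com_vars P \<union> com_vars Q)" by (simp add: finite_com_vars)
  then obtain k where "\<forall>v \<in> com_vars P \<union> com_vars Q. v \<le> k"
    by (meson finite_nat_set_iff_bounded_le)
  then show thesis by (intro that[of "Suc k"]) (auto simp: less_Suc_eq_le)
qed


section \<open>Functions computable in polynomial time\<close>

text \<open>One overloaded encoding makes the closure lemmas polymorphic.
  \<open>enc_assignment_eq\<close>, \<open>enc_cnf_eq\<close> and \<open>enc_input_eq\<close> later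
  identify it with the prescribed encodings.\<close>

class enc =
  fixes enc :: "'a \<Rightarrow> tree"

instantiation nat :: enc
begin
definition "enc = enc_nat"
instance ..
end

instantiation bool :: enc
begin
definition "enc = enc_bool"
instance ..
end

instantiation com :: enc
begin
definition "enc = enc_com"
instance ..
end

instantiation list :: (enc) enc
begin
definition "enc xs = enc_list (map enc xs)"
instance ..
end

instantiation prod :: (enc, enc) enc
begin
definition "enc p = Node (enc (fst p)) (enc (snd p))"
instance ..
end

section \<open>Sizes of encodings\<close>

abbreviation esize :: "'a::enc \<Rightarrow> nat" where
  "esize x \<equiv> size (enc x)"

lemma enc_Nil [simp]: "enc [] = Leaf"
  and enc_Cons [simp]: "enc (x # xs) = Node (enc x) (enc xs)"
  by (simp_all add: enc_list_def)

lemma enc_Pair [simp]: "enc (x, y) = Node (enc x) (enc y)"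
  by (simp add: enc_prod_def)

lemma enc_0 [simp]: "enc (0::nat) = Leaf"
  and enc_Suc [simp]: "enc (Suc n) = Node Leaf (enc n)"
  by (simp_all add: enc_nat_def Defs.enc_nat_def)

lemma enc_bool_simps [simp]: "enc True = Node Leaf Leaf" "enc False = Leaf"
  by (simp_all add: enc_bool_def Defs.enc_bool_def)

text \<open>\<open>size\<close> counts inner nodes and numbers are unary. A number computed in
  polynomial time is therefore polynomially bounded in value.\<close>

lemma esize_nat [simp]: "esize (n::nat) = n"
  by (induction n) auto

lemma esize_list: "esize xs = (\<Sum>x\<leftarrow>xs. esize x + 1)"
  by (induction xs) auto

lemma esize_append: "esize (xs @ ys) = esize xs + esize ys"
  by (simp add: esize_list)

lemma length_le_esize: "length xs \<le> esize xs"
  by (induction xs) auto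

lemma esize_member: "x \<in> set xs \<Longrightarrow> esize x < esize xs"
  by (induction xs) auto

lemma esize_list_le: "(\<And>x. x \<in> set xs \<Longrightarrow> esize x \<le> B) \<Longrightarrow> esize xs \<le> length xs * (B + 1)"
proof (induction xs)
  case (Cons x xs)
  then have "esize x \<le> B" "esize xs \<le> length xs * (B + 1)" by auto
  then show ?case by simp
qed simp

lemma esize_rev [simp]: "esize (rev xs) = esize xs"
  by (simp add: esize_list flip: rev_map)

section \<open>Polynomial bounds in the size of the encoded argument\<close>

definition pbounded :: "('a::enc \<Rightarrow> nat) \<Rightarrow> bool" where
  "pbounded f \<longleftrightarrow> (\<exists>d. \<forall>x. f x \<le> (esize x + 2) ^ d)"

lemma pbounded_mono: "pbounded g \<Longrightarrow> (\<And>x. f x \<le> g x) \<Longrightarrow> pbounded f"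
  unfolding pbounded_def by (meson order_trans)

lemma pbounded_const: "pbounded (\<lambda>x. c)"
  unfolding pbounded_def
proof (intro exI allI)
  fix x :: 'a
  have "c \<le> 2 ^ c" using less_exp[of c] by simp
  also have "\<dots> \<le> (esize x + 2) ^ c" by (rule power_mono) auto
  finally show "c \<le> (esize x + 2) ^ c" .
qed

lemma pbounded_esize: "pbounded esize"
  unfolding pbounded_def by (rule exI[of _ 1]) simp

lemma pbounded_mult: "pbounded f \<Longrightarrow> pbounded g \<Longrightarrow> pbounded (\<lambda>x. f x * g x)"
proof -
  assume "pbounded f" "pbounded g"
  then obtain d e where "\<And>x. f x \<le> (esize x + 2) ^ d" "\<And>x. g x \<le> (esize x + 2) ^ e"
    unfolding pbounded_def by auto
  then have "f x * g x \<le> (esize x + 2) ^ (d + e)" for x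
    unfolding power_add by (intro mult_le_mono)
  then show ?thesis unfolding pbounded_def by blast
qed

text \<open>The base \<open>esize x + 2\<close> is at least 2, so one more factor absorbs the sum of
  two powers.\<close>

lemma pbounded_add:
  assumes "pbounded f" "pbounded g"
  shows "pbounded (\<lambda>x. f x + g x)"
proof -
  obtain d e where d: "\<And>x. f x \<le> (esize x + 2) ^ d" and e: "\<And>x. g x \<le> (esize x + 2) ^ e"
    using assms unfolding pbounded_def by auto
  have "f x + g x \<le> (esize x + 2) ^ (d + e + 1)" for x
  proof -
    let ?y = "esize x + 2"
    have "?y ^ d \<le> ?y ^ (d + e)" "?y ^ e \<le> ?y ^ (d + e)" by (simp_all add: power_increasing)
    then have "f x + g x \<le> 2 * ?y ^ (d + e)" using d[of x] e[of x] by linarith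
    also have "\<dots> \<le> ?y * ?y ^ (d + e)" by (intro mult_le_mono1) simp
    finally show ?thesis by (simp add: power_add)
  qed
  then show ?thesis unfolding pbounded_def by blast
qed

lemma pbounded_compose:
  assumes "pbounded g" "pbounded (\<lambda>x. esize (f x))"
  shows "pbounded (\<lambda>x. g (f x))"
proof -
  obtain d :: nat where d: "\<And>y. g y \<le> (esize y + 2) ^ d"
    using assms(1) unfolding pbounded_def by auto
  have "pbounded (\<lambda>x. esize (f x) + 2)" by (intro pbounded_add pbounded_const assms)
  then obtain e :: nat where e: "\<And>x. esize (f x) + 2 \<le> (esize x + 2) ^ e"
    unfolding pbounded_def by auto
  have "g (f x) \<le> (esize x + 2) ^ (e * d)" for x
    unfolding power_mult using d[of "f x"] power_mono[OF e[of x], of d] by simp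
  then show ?thesis unfolding pbounded_def by blast
qed

lemma pbounded_power: "pbounded f \<Longrightarrow> pbounded (\<lambda>x. f x ^ d)"
  by (induction d) (auto intro: pbounded_const pbounded_mult)

text \<open>The size of the result has to be bounded separately, since it may be exponential in the
  running time: assignments copy trees at unit cost.\<close>

definition ptime :: "('a::enc \<Rightarrow> 'b::enc) \<Rightarrow> bool" where
  "ptime f \<longleftrightarrow> pbounded (\<lambda>x. esize (f x)) \<and>
     (\<exists>P T. pbounded T \<and>
       (\<forall>x. \<exists>t \<le> T x. exec P (init_state (enc x)) t (init_state (enc (f x)))))"

lemma ptimeI:
  assumes "pbounded (\<lambda>x. esize (f x))" "pbounded T"
    "\<And>x. \<exists>t \<le> T x. exec P (init_state (enc x)) t (init_state (enc (f x)))"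
  shows "ptime f"
  using assms unfolding ptime_def by blast

lemma ptimeE:
  assumes "ptime f"
  obtains P T where "pbounded T"
    "\<And>x. \<exists>t \<le> T x. exec P (init_state (enc x)) t (init_state (enc (f x)))"
  using assms unfolding ptime_def by blast

lemma ptime_esize: "ptime f \<Longrightarrow> pbounded (\<lambda>x. esize (f x))"
  unfolding ptime_def by blast

section \<open>Closure of the polynomial-time functions under program constructs\<close>

lemma ptime_exp:
  assumes "\<And>x. eval_exp e (init_state (enc x)) = enc (f x)" "pbounded (\<lambda>x. esize (f x))"
  shows "ptime f"
proof (rule ptimeI[OF assms(2) pbounded_const])
  show "\<exists>t \<le> 1 + exp_cost e. exec (Assign 0 e) (init_state (enc x)) t (init_state (enc (f x)))" for x
    by (rule exI[of _ "1 + exp_cost e"])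
      (auto intro!: exec_AssignI simp: assms(1)[symmetric] init_state_def)
qed

lemma ptime_id: "ptime (\<lambda>x. x)"
  by (rule ptime_exp[where e = "EVar 0"]) (auto simp: init_state_def pbounded_esize)

lemma ptime_const: "ptime (\<lambda>x. c)"
  by (rule ptime_exp[where e = "EConst (enc c)"]) (auto simp: pbounded_const)

text \<open>The second program runs on \<open>f x\<close>; its time is polynomial in the size of
  \<open>x\<close> because the size of \<open>f x\<close> is. This is where the size clause of
  \<open>ptime\<close> enters.\<close>

lemma ptime_comp:
  assumes "ptime g" "ptime f"
  shows "ptime (\<lambda>x. g (f x))"
proof -
  obtain P S where P: "pbounded S"
    "\<And>x. \<exists>t \<le> S x. exec P (init_state (enc x)) t (init_state (enc (f x)))"
    by (rule ptimeE[OF assms(2)], rule that)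
  obtain Q T where Q: "pbounded T"
    "\<And>x. \<exists>t \<le> T x. exec Q (init_state (enc x)) t (init_state (enc (g x)))"
    by (rule ptimeE[OF assms(1)], rule that)
  note f = ptime_esize[OF assms(2)]
  show ?thesis
  proof (rule ptimeI)
    show "pbounded (\<lambda>x. esize (g (f x)))"
      by (rule pbounded_compose[OF ptime_esize[OF assms(1)] f])
    show "pbounded (\<lambda>x. S x + T (f x))"
      by (intro pbounded_add P pbounded_compose[OF Q(1) f])
    fix x
    obtain t u where "t \<le> S x" "exec P (init_state (enc x)) t (init_state (enc (f x)))"
      "u \<le> T (f x)" "exec Q (init_state (enc (f x))) u (init_state (enc (g (f x))))"
      using P(2)[of x] Q(2)[of "f x"] by blast
    then show "\<exists>t \<le> S x + T (f x).
        exec (Seq P Q) (init_state (enc x)) t (init_state (enc (g (f x))))"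
      by (intro exec_withinI[OF exec_Seq] add_le_mono)
  qed
qed

text \<open>The caller keeps a copy of the input in variable \<open>m\<close> and the first result
  in \<open>Suc m\<close>, above all variables of the subroutines, and clears both at the
  end.\<close>

lemma ptime_Pair:
  assumes "ptime f" "ptime g"
  shows "ptime (\<lambda>x. (f x, g x))"
proof -
  obtain P S where P: "pbounded S"
    "\<And>x. \<exists>t \<le> S x. exec P (init_state (enc x)) t (init_state (enc (f x)))"
    by (rule ptimeE[OF assms(1)], rule that)
  obtain Q T where Q: "pbounded T"
    "\<And>x. \<exists>t \<le> T x. exec Q (init_state (enc x)) t (init_state (enc (g x)))"
    by (rule ptimeE[OF assms(2)], rule that)
  obtain m where m: "0 < m" "com_vars P \<subseteq> {..<m}" "com_vars Q \<subseteq> {..<m}"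
    using obtain_var_bound by metis
  let ?C = "Seq (Assign m (EVar 0)) (Seq P (Seq (Assign (Suc m) (EVar 0))
    (Seq (Assign 0 (EVar m)) (Seq Q (Seq (Assign 0 (ECons (EVar (Suc m)) (EVar 0)))
    (Seq (Assign m (EConst Leaf)) (Assign (Suc m) (EConst Leaf))))))))"
  show ?thesis
  proof (rule ptimeI)
    have "esize (f x, g x) = esize (f x) + esize (g x) + 1" for x by simp
    then show "pbounded (\<lambda>x. esize (f x, g x))"
      by (simp only:) (intro pbounded_add pbounded_const ptime_esize assms)
    show "pbounded (\<lambda>x. S x + T x + 20)"
      by (intro pbounded_add P Q pbounded_const)
    fix x
    obtain t where t: "t \<le> S x" "exec P (init_state (enc x)) t (init_state (enc (f x)))"
      using P(2)[of x] by blast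
    obtain u where u: "u \<le> T x" "exec Q (init_state (enc x)) u (init_state (enc (g x)))"
      using Q(2)[of x] by blast
    let ?F = "frame m"
    have "exec (Assign m (EVar 0)) (?F (enc x) Leaf Leaf Leaf) 2 (?F (enc x) (enc x) Leaf Leaf)"
      by (rule exec_AssignI) (simp_all add: frame_apply frame_update m)
    moreover have "exec P (?F (enc x) (enc x) Leaf Leaf) t (?F (enc (f x)) (enc x) Leaf Leaf)"
      by (rule exec_in_frame) (use t m in auto)
    moreover have "exec (Assign (Suc m) (EVar 0)) (?F (enc (f x)) (enc x) Leaf Leaf) 2
        (?F (enc (f x)) (enc x) (enc (f x)) Leaf)"
      by (rule exec_AssignI) (simp_all add: frame_apply frame_update m)
    moreover have "exec (Assign 0 (EVar m)) (?F (enc (f x)) (enc x) (enc (f x)) Leaf) 2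
        (?F (enc x) (enc x) (enc (f x)) Leaf)"
      by (rule exec_AssignI) (simp_all add: frame_apply frame_update m)
    moreover have "exec Q (?F (enc x) (enc x) (enc (f x)) Leaf) u
        (?F (enc (g x)) (enc x) (enc (f x)) Leaf)"
      by (rule exec_in_frame) (use u m in auto)
    moreover have "exec (Assign 0 (ECons (EVar (Suc m)) (EVar 0)))
        (?F (enc (g x)) (enc x) (enc (f x)) Leaf) 4 (?F (enc (f x, g x)) (enc x) (enc (f x)) Leaf)"
      by (rule exec_AssignI) (simp_all add: frame_apply frame_update m)
    moreover have "exec (Assign m (EConst Leaf)) (?F (enc (f x, g x)) (enc x) (enc (f x)) Leaf) 2
        (?F (enc (f x, g x)) Leaf (enc (f x)) Leaf)"
      by (rule exec_AssignI) (simp_all add: frame_apply frame_update m)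
    moreover have "exec (Assign (Suc m) (EConst Leaf)) (?F (enc (f x, g x)) Leaf (enc (f x)) Leaf) 2
        (?F (enc (f x, g x)) Leaf Leaf Leaf)"
      by (rule exec_AssignI) (simp_all add: frame_apply frame_update m)
    ultimately have "exec ?C (?F (enc x) Leaf Leaf Leaf) (2 + (t + (2 + (2 + (u + (4 + (2 + 2)))))))
        (?F (enc (f x, g x)) Leaf Leaf Leaf)"
      by (intro exec_Seq)
    then show "\<exists>t \<le> S x + T x + 20.
        exec ?C (init_state (enc x)) t (init_state (enc (f x, g x)))"
      unfolding init_state_eq_frame[OF m(1)] by (rule exec_withinI) (use t(1) u(1) in simp)
  qed
qed

lemma ptime_If:
  assumes "ptime c" "ptime f" "ptime g"
  shows "ptime (\<lambda>x. if c x then f x else g x)"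
proof -
  obtain P S where P: "pbounded S"
    "\<And>x. \<exists>t \<le> S x. exec P (init_state (enc x)) t (init_state (enc (f x)))"
    by (rule ptimeE[OF assms(2)], rule that)
  obtain Q T where Q: "pbounded T"
    "\<And>x. \<exists>t \<le> T x. exec Q (init_state (enc x)) t (init_state (enc (g x)))"
    by (rule ptimeE[OF assms(3)], rule that)
  let ?C = "\<lambda>R. Seq (Assign 0 (ETl (EVar 0))) R"
  have tl: "exec (Assign 0 (ETl (EVar 0))) (init_state (Node a b)) 3 (init_state b)" for a b
    by (rule exec_AssignI) (auto simp: init_state_def)
  have snd: "pbounded (\<lambda>p :: bool \<times> 'a. esize (snd p))"
    by (rule pbounded_mono[OF pbounded_esize]) (auto simp: enc_prod_def)
  \<comment> \<open>First for pairs of an already computed condition and the input: the program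
    tests the head and passes on the tail.\<close>
  have "ptime (\<lambda>p. if fst p then f (snd p) else g (snd p))"
  proof (rule ptimeI)
    show "pbounded (\<lambda>p. esize (if fst p then f (snd p) else g (snd p)))"
      by (rule pbounded_mono[OF pbounded_add[OF
            pbounded_compose[OF ptime_esize[OF assms(2)] snd]
            pbounded_compose[OF ptime_esize[OF assms(3)] snd]]]) auto
    show "pbounded (\<lambda>p :: bool \<times> 'a. 6 + S (snd p) + T (snd p))"
      by (intro pbounded_add pbounded_const pbounded_compose[OF P(1) snd]
          pbounded_compose[OF Q(1) snd])
    fix p :: "bool \<times> 'a"
    obtain b x where p: "p = (b, x)" by force
    obtain t where t: "t \<le> S x" "exec P (init_state (enc x)) t (init_state (enc (f x)))"
      using P(2)[of x] by blast
    obtain u where u: "u \<le> T x" "exec Q (init_state (enc x)) u (init_state (enc (g x)))"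
      using Q(2)[of x] by blast
    show "\<exists>t \<le> 6 + S (snd p) + T (snd p). exec (If (EHd (EVar 0)) (?C P) (?C Q))
        (init_state (enc p)) t (init_state (enc (if fst p then f (snd p) else g (snd p))))"
    proof (cases b)
      case True
      have "exec (If (EHd (EVar 0)) (?C P) (?C Q)) (init_state (enc p))
          (1 + exp_cost (EHd (EVar 0)) + (3 + t)) (init_state (enc (f x)))"
        by (rule exec_IfTrue[OF _ exec_Seq])
          (use True t tl in \<open>auto simp: p init_state_def\<close>)
      from exec_withinI[OF this, of "6 + S x + T x"] t(1) show ?thesis by (simp add: p True)
    next
      case False
      have "exec (If (EHd (EVar 0)) (?C P) (?C Q)) (init_state (enc p))
          (1 + exp_cost (EHd (EVar 0)) + (3 + u)) (init_state (enc (g x)))"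
        by (rule exec_IfFalse[OF _ exec_Seq])
          (use False u tl in \<open>auto simp: p init_state_def\<close>)
      from exec_withinI[OF this, of "6 + S x + T x"] u(1) show ?thesis by (simp add: p False)
    qed
  qed
  then have "ptime (\<lambda>x. (\<lambda>p. if fst p then f (snd p) else g (snd p)) (c x, x))"
    by (rule ptime_comp) (intro ptime_Pair assms ptime_id)
  then show ?thesis by (simp only: fst_conv snd_conv cong: if_cong)
qed

text \<open>Variable \<open>m\<close> holds the parameter, \<open>Suc m\<close> the remaining list
  and the next one the accumulator; variable 0 passes the triple to \<open>H\<close> and receives
  the new accumulator. A round costs 14 units besides \<open>H\<close>, the final test 2.
  \<open>w\<close> is whatever remains in variable 0.\<close>

lemma exec_foldl_loop:
  assumes "0 < m" "com_vars H \<subseteq> {..<m}"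
    and H: "\<And>y. \<exists>t \<le> T y. exec H (init_state (enc y)) t
      (init_state (enc (h (fst y) (fst (snd y)) (snd (snd y)))))"
    and T: "\<And>ys a zs. as = ys @ a # zs \<Longrightarrow> T (x, foldl (h x) s ys, a) \<le> B"
  shows "\<exists>w. \<exists>t \<le> length as * (B + 14) + 2.
    exec (While (EVar (Suc m))
        (Seq (Assign 0 (ECons (EVar m) (ECons (EVar (Suc (Suc m))) (EHd (EVar (Suc m))))))
        (Seq H (Seq (Assign (Suc (Suc m)) (EVar 0)) (Assign (Suc m) (ETl (EVar (Suc m))))))))
      (frame m v (enc x) (enc as) (enc s)) t
      (frame m w (enc x) Leaf (enc (foldl (h x) s as)))"
    (is "\<exists>w. \<exists>t \<le> _. exec (While ?e ?c) _ _ _")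
  using T
proof (induction as arbitrary: s v)
  case Nil
  have "exec (While ?e ?c) (frame m v (enc x) Leaf (enc s)) (1 + exp_cost ?e)
      (frame m v (enc x) Leaf (enc s))"
    by (rule exec_WhileFalse) (simp add: frame_apply assms)
  then show ?case by (intro exI[of _ v] exec_withinI) auto
next
  case (Cons a as)
  let ?F = "frame m" and ?s = "h x s a"
  obtain t where t: "t \<le> T (x, s, a)"
    "exec H (init_state (enc (x, s, a))) t (init_state (enc ?s))"
    using H[of "(x, s, a)"] by auto
  have tB: "t \<le> B" using t(1) Cons.prems[of "[]" a as] by simp
  have tail: "T (x, foldl (h x) ?s ys, b) \<le> B" if "as = ys @ b # zs" for ys b zs
    using Cons.prems[of "a # ys" b zs] that by simp
  obtain w u where u: "u \<le> length as * (B + 14) + 2"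
    "exec (While ?e ?c) (?F (enc ?s) (enc x) (enc as) (enc ?s)) u
      (?F w (enc x) Leaf (enc (foldl (h x) ?s as)))"
    using Cons.IH[where s = ?s and v = "enc ?s"] tail by blast
  have "exec (Assign 0 (ECons (EVar m) (ECons (EVar (Suc (Suc m))) (EHd (EVar (Suc m))))))
      (?F v (enc x) (enc (a # as)) (enc s)) 7 (?F (enc (x, s, a)) (enc x) (enc (a # as)) (enc s))"
    by (rule exec_AssignI) (simp_all add: frame_apply frame_update assms)
  moreover have "exec H (?F (enc (x, s, a)) (enc x) (enc (a # as)) (enc s)) t
      (?F (enc ?s) (enc x) (enc (a # as)) (enc s))"
    by (rule exec_in_frame[OF t(2)]) (use assms in auto)
  moreover have "exec (Assign (Suc (Suc m)) (EVar 0)) (?F (enc ?s) (enc x) (enc (a # as)) (enc s)) 2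
      (?F (enc ?s) (enc x) (enc (a # as)) (enc ?s))"
    by (rule exec_AssignI) (simp_all add: frame_apply frame_update assms)
  moreover have "exec (Assign (Suc m) (ETl (EVar (Suc m))))
      (?F (enc ?s) (enc x) (enc (a # as)) (enc ?s)) 3 (?F (enc ?s) (enc x) (enc as) (enc ?s))"
    by (rule exec_AssignI) (simp_all add: frame_apply frame_update assms)
  ultimately have "exec ?c (?F v (enc x) (enc (a # as)) (enc s)) (7 + (t + (2 + 3)))
      (?F (enc ?s) (enc x) (enc as) (enc ?s))"
    by (intro exec_Seq)
  then have "exec (While ?e ?c) (?F v (enc x) (enc (a # as)) (enc s))
      (1 + exp_cost ?e + (7 + (t + (2 + 3))) + u) (?F w (enc x) Leaf (enc (foldl (h x) ?s as)))"
    by (intro exec_WhileTrue) (use u in \<open>simp_all add: frame_apply assms\<close>)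
  moreover have "1 + exp_cost ?e + (7 + (t + (2 + 3))) + u \<le> length (a # as) * (B + 14) + 2"
    using tB u(1) by simp
  ultimately show ?case unfolding foldl_Cons by blast
qed

text \<open>Iterating a polynomial-time step can make the accumulator grow exponentially, so a
  polynomial bound \<open>B\<close> on the fold over every prefix is assumed. With it each call of
  the step takes polynomial time.\<close>

lemma ptime_foldl:
  assumes "ptime l" "ptime i" "ptime (\<lambda>p. h (fst p) (fst (snd p)) (snd (snd p)))"
    and "pbounded B"
    and B: "\<And>x ys zs. l x = ys @ zs \<Longrightarrow> esize (foldl (h x) (i x) ys) \<le> B x"
  shows "ptime (\<lambda>x. foldl (h x) (i x) (l x))"
proof -
  have start: "ptime (\<lambda>x. (x, l x, i x))" by (intro ptime_Pair ptime_id assms)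
  obtain P S where P: "pbounded S"
    "\<And>x. \<exists>t \<le> S x. exec P (init_state (enc x)) t (init_state (enc (x, l x, i x)))"
    by (rule ptimeE[OF start], rule that)
  obtain H T where H: "pbounded T"
    "\<And>y. \<exists>t \<le> T y. exec H (init_state (enc y)) t
      (init_state (enc (h (fst y) (fst (snd y)) (snd (snd y)))))"
    by (rule ptimeE[OF assms(3)], rule that)
  obtain d :: nat where d: "\<And>y. T y \<le> (esize y + 2) ^ d" using H(1) unfolding pbounded_def by blast
  \<comment> \<open>Bounds the time of every call: an entry is smaller than the list, and the 4
    consists of the two pairing nodes of the triple and the 2 from \<open>pbounded\<close>.\<close>
  define Z where "Z x = (esize x + B x + esize (l x) + 4) ^ d" for x
  have Z: "pbounded Z" unfolding Z_def
    by (intro pbounded_power pbounded_add pbounded_const pbounded_esize assms(4)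
        ptime_esize[OF assms(1)])
  have TZ: "T (x, foldl (h x) (i x) ys, a) \<le> Z x" if "l x = ys @ a # zs" for x ys a zs
  proof -
    have "esize (foldl (h x) (i x) ys) \<le> B x" using B that by blast
    moreover have "esize a < esize (l x)" using that by (intro esize_member) simp
    ultimately have "(esize (x, foldl (h x) (i x) ys, a) + 2) ^ d \<le> Z x"
      unfolding Z_def by (intro power_mono) auto
    then show ?thesis using d le_trans by blast
  qed
  obtain m where m: "0 < m" "com_vars P \<subseteq> {..<m}" "com_vars H \<subseteq> {..<m}"
    using obtain_var_bound by metis
  let ?L = "While (EVar (Suc m))
        (Seq (Assign 0 (ECons (EVar m) (ECons (EVar (Suc (Suc m))) (EHd (EVar (Suc m))))))
        (Seq H (Seq (Assign (Suc (Suc m)) (EVar 0)) (Assign (Suc m) (ETl (EVar (Suc m)))))))"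
  let ?C = "Seq P (Seq (Assign m (EHd (EVar 0))) (Seq (Assign (Suc m) (EHd (ETl (EVar 0))))
    (Seq (Assign (Suc (Suc m)) (ETl (ETl (EVar 0)))) (Seq ?L (Seq (Assign 0 (EVar (Suc (Suc m))))
    (Seq (Assign m (EConst Leaf)) (Assign (Suc (Suc m)) (EConst Leaf))))))))"
  show ?thesis
  proof (rule ptimeI)
    show "pbounded (\<lambda>x. esize (foldl (h x) (i x) (l x)))"
      by (rule pbounded_mono[OF assms(4)]) (rule B, simp)
    show "pbounded (\<lambda>x. S x + esize (l x) * (Z x + 14) + 20)"
      by (intro pbounded_add pbounded_mult pbounded_const P Z ptime_esize[OF assms(1)])
    fix x
    let ?F = "frame m" and ?x = "enc x" and ?l = "enc (l x)" and ?i = "enc (i x)"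
    let ?r = "enc (foldl (h x) (i x) (l x))" and ?y = "enc (x, l x, i x)"
    obtain t where t: "t \<le> S x" "exec P (init_state (enc x)) t (init_state (enc (x, l x, i x)))"
      using P(2)[of x] by blast
    obtain w u where u: "u \<le> length (l x) * (Z x + 14) + 2"
      "exec ?L (?F ?y ?x ?l ?i) u (?F w ?x Leaf ?r)"
      using exec_foldl_loop[of m H T h "l x" x "i x" "Z x" ?y] m H(2) TZ by blast
    have "u \<le> esize (l x) * (Z x + 14) + 2"
      using u(1) mult_le_mono1[OF length_le_esize[of "l x"], of "Z x + 14"] by linarith
    with t(1) have le: "t + (3 + (4 + (4 + (u + (2 + (2 + 2))))))
        \<le> S x + esize (l x) * (Z x + 14) + 20" by linarith
    have "exec P (?F ?x Leaf Leaf Leaf) t (?F ?y Leaf Leaf Leaf)"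
      by (rule exec_in_frame) (use t m in auto)
    moreover have "exec (Assign m (EHd (EVar 0))) (?F ?y Leaf Leaf Leaf) 3 (?F ?y ?x Leaf Leaf)"
      by (rule exec_AssignI) (simp_all add: frame_apply frame_update m)
    moreover have "exec (Assign (Suc m) (EHd (ETl (EVar 0)))) (?F ?y ?x Leaf Leaf) 4
        (?F ?y ?x ?l Leaf)"
      by (rule exec_AssignI) (simp_all add: frame_apply frame_update m)
    moreover have "exec (Assign (Suc (Suc m)) (ETl (ETl (EVar 0)))) (?F ?y ?x ?l Leaf) 4
        (?F ?y ?x ?l ?i)"
      by (rule exec_AssignI) (simp_all add: frame_apply frame_update m)
    moreover note u(2)
    moreover have "exec (Assign 0 (EVar (Suc (Suc m)))) (?F w ?x Leaf ?r) 2 (?F ?r ?x Leaf ?r)"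
      by (rule exec_AssignI) (simp_all add: frame_apply frame_update m)
    moreover have "exec (Assign m (EConst Leaf)) (?F ?r ?x Leaf ?r) 2 (?F ?r Leaf Leaf ?r)"
      by (rule exec_AssignI) (simp_all add: frame_apply frame_update m)
    moreover have "exec (Assign (Suc (Suc m)) (EConst Leaf)) (?F ?r Leaf Leaf ?r) 2
        (?F ?r Leaf Leaf Leaf)"
      by (rule exec_AssignI) (simp_all add: frame_apply frame_update m)
    ultimately have "exec ?C (?F ?x Leaf Leaf Leaf) (t + (3 + (4 + (4 + (u + (2 + (2 + 2)))))))
        (?F ?r Leaf Leaf Leaf)"
      by (intro exec_Seq)
    then show "\<exists>t \<le> S x + esize (l x) * (Z x + 14) + 20.
        exec ?C (init_state (enc x)) t (init_state (enc (foldl (h x) (i x) (l x))))"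
      unfolding init_state_eq_frame[OF m(1)] using le by (rule exec_withinI)
  qed
qed

section \<open>Functions on pairs, numbers and truth values\<close>

named_theorems ptime_intros

lemmas [ptime_intros] = ptime_id ptime_const ptime_Pair ptime_If

text \<open>Composition with an arbitrary \<open>f\<close> puts each rule into a form that
  \<open>intro\<close> can apply to any argument, so that \<open>ptime\<close> follows along the
  syntax of a definition.\<close>

lemma ptime_compI:
  assumes "ptime f" and "\<And>x. eval_exp e (init_state (enc x)) = enc (g x)"
    and "pbounded (\<lambda>x. esize (g x))"
  shows "ptime (\<lambda>x. g (f x))"
  by (rule ptime_comp[OF ptime_exp assms(1)]) (use assms in auto)

lemma ptime_fst [ptime_intros]: "ptime f \<Longrightarrow> ptime (\<lambda>x. fst (f x))"
  by (erule ptime_compI[where e = "EHd (EVar 0)"])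
    (auto intro!: pbounded_mono[OF pbounded_esize] simp: init_state_def enc_prod_def)

lemma ptime_snd [ptime_intros]: "ptime f \<Longrightarrow> ptime (\<lambda>x. snd (f x))"
  by (erule ptime_compI[where e = "ETl (EVar 0)"])
    (auto intro!: pbounded_mono[OF pbounded_esize] simp: init_state_def enc_prod_def)

lemma ptime_Cons [ptime_intros]:
  assumes "ptime f" "ptime g"
  shows "ptime (\<lambda>x. f x # g x)"
proof -
  \<comment> \<open>A nonempty list and the pair of its head and tail have the same encoding, so the
    program is the identity.\<close>
  have "ptime (\<lambda>x. (\<lambda>p. fst p # snd p) (f x, g x))"
    by (rule ptime_compI[where e = "EVar 0", OF ptime_Pair[OF assms]])
      (auto intro!: pbounded_mono[OF pbounded_esize] simp: init_state_def enc_prod_def)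
  then show ?thesis by simp
qed

lemma ptime_Suc [ptime_intros]: "ptime f \<Longrightarrow> ptime (\<lambda>x. Suc (f x))"
  by (erule ptime_compI[where e = "ECons (EConst Leaf) (EVar 0)"])
    (auto intro!: pbounded_mono[OF pbounded_add[OF pbounded_esize pbounded_const[of 1]]]
      simp: init_state_def)

lemma ptime_pred [ptime_intros]: "ptime f \<Longrightarrow> ptime (\<lambda>x. f x - Suc 0)"
proof (erule ptime_compI[where e = "ETl (EVar 0)"])
  show "eval_exp (ETl (EVar 0)) (init_state (enc n)) = enc (n - Suc 0)" for n
    by (cases n) (auto simp: init_state_def)
qed (auto intro!: pbounded_mono[OF pbounded_esize])

lemma ptime_eq_0 [ptime_intros]: "ptime f \<Longrightarrow> ptime (\<lambda>x. f x = (0::nat))"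
proof (rule ptime_comp[of "\<lambda>n::nat. n = 0"])
  let ?C = "If (EVar 0) (Assign 0 (EConst Leaf)) (Assign 0 (EConst (Node Leaf Leaf)))"
  show "ptime (\<lambda>n::nat. n = 0)"
  proof (rule ptimeI)
    show "pbounded (\<lambda>n::nat. esize (n = 0))"
      by (rule pbounded_mono[OF pbounded_const[of 1]])
        (simp add: enc_bool_def Defs.enc_bool_def)
    show "pbounded (\<lambda>n::nat. 4)" by (rule pbounded_const)
    show "\<exists>t \<le> 4. exec ?C (init_state (enc n)) t (init_state (enc (n = 0)))" for n :: nat
    proof (cases "n = 0")
      case True
      have "exec ?C (init_state (enc n)) (1 + exp_cost (EVar 0) + 2) (init_state (enc (n = 0)))"
        by (rule exec_IfFalse[OF _ exec_AssignI]) (use True in \<open>auto simp: init_state_def\<close>)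
      then show ?thesis by (rule exec_withinI) simp
    next
      case False
      then obtain k where "n = Suc k" by (cases n) auto
      then have "exec ?C (init_state (enc n)) (1 + exp_cost (EVar 0) + 2) (init_state (enc (n = 0)))"
        by (intro exec_IfTrue[OF _ exec_AssignI]) (auto simp: init_state_def)
      then show ?thesis by (rule exec_withinI) simp
    qed
  qed
qed

text \<open>A unary number and a list of that many zeros have the same encoding. A loop over a list
  thus also serves as a counting loop, as in \<open>ptime_funpow\<close>.\<close>

lemma ptime_replicate_0: "ptime f \<Longrightarrow> ptime (\<lambda>x. replicate (f x) (0::nat))"
proof (erule ptime_compI[where e = "EVar 0"])
  have *: "enc (replicate n (0::nat)) = enc n" for n by (induction n) auto
  show "eval_exp (EVar 0) (init_state (enc n)) = enc (replicate n (0::nat))" for n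
    by (simp add: * init_state_def)
  show "pbounded (\<lambda>n. esize (replicate n (0::nat)))" unfolding * by (rule pbounded_esize)
qed

lemma foldl_replicate: "foldl (\<lambda>s _. h s) i (replicate n a) = (h ^^ n) i"
  by (induction n arbitrary: i) (auto simp: funpow_swap1)

lemma ptime_funpow:
  fixes h :: "'a::enc \<Rightarrow> 'b::enc \<Rightarrow> 'b"
  assumes "ptime n" "ptime i" "ptime (\<lambda>p. h (fst p) (snd p))" "pbounded B"
    and B: "\<And>x k. k \<le> n x \<Longrightarrow> esize ((h x ^^ k) (i x)) \<le> B x"
  shows "ptime (\<lambda>x. (h x ^^ n x) (i x))"
proof -
  have "ptime (\<lambda>x. foldl (\<lambda>s _. h x s) (i x) (replicate (n x) (0::nat)))"
  proof (rule ptime_foldl[OF ptime_replicate_0[OF assms(1)] assms(2) _ assms(4)])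
    have "ptime (\<lambda>p :: 'a \<times> 'b \<times> nat. (\<lambda>q. h (fst q) (snd q)) (fst p, fst (snd p)))"
      by (rule ptime_comp[OF assms(3)]) (intro ptime_intros)
    then show "ptime (\<lambda>p :: 'a \<times> 'b \<times> nat. h (fst p) (fst (snd p)))" by simp
    fix x ys zs assume "replicate (n x) (0::nat) = ys @ zs"
    then have "ys = replicate (length ys) 0" "length ys \<le> n x"
      by (metis append_eq_conv_conj take_replicate length_replicate,
          metis length_append length_replicate le_add1)
    then show "esize (foldl (\<lambda>s _. h x s) (i x) ys) \<le> B x"
      by (metis B foldl_replicate)
  qed
  then show ?thesis by (simp add: foldl_replicate)
qed

lemma ptime_nat_pbounded: "ptime f \<Longrightarrow> pbounded (\<lambda>x. f x :: nat)"
  using ptime_esize by fastforce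

lemma ptime_add [ptime_intros]:
  assumes "ptime f" "ptime g"
  shows "ptime (\<lambda>x. f x + g x :: nat)"
proof -
  have eq: "(Suc ^^ n) m = m + n" for m n by (induction n) auto
  have "ptime (\<lambda>x. (Suc ^^ g x) (f x))"
    by (rule ptime_funpow[where B = "\<lambda>x. f x + g x"])
      (intro ptime_intros assms pbounded_add assms[THEN ptime_nat_pbounded] | simp add: eq)+
  then show ?thesis by (simp only: eq)
qed

lemma ptime_mult [ptime_intros]:
  assumes "ptime f" "ptime g"
  shows "ptime (\<lambda>x. f x * g x :: nat)"
proof -
  have eq: "((\<lambda>s. s + m) ^^ n) 0 = m * n" for m n :: nat by (induction n) auto
  have "ptime (\<lambda>x. ((\<lambda>s. s + f x) ^^ g x) 0)"
    by (rule ptime_funpow[where B = "\<lambda>x. f x * g x"])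
      (intro ptime_intros assms pbounded_mult assms[THEN ptime_nat_pbounded]
        ptime_comp[OF assms(1)] | simp add: eq)+
  then show ?thesis by (simp add: eq)
qed

lemma ptime_diff [ptime_intros]:
  assumes "ptime f" "ptime g"
  shows "ptime (\<lambda>x. f x - g x :: nat)"
proof -
  have eq: "((\<lambda>s. s - Suc 0) ^^ n) m = m - n" for m n :: nat by (induction n) auto
  have "ptime (\<lambda>x. ((\<lambda>s. s - Suc 0) ^^ g x) (f x))"
    by (rule ptime_funpow[where B = f])
      (intro ptime_intros assms assms[THEN ptime_nat_pbounded] | simp add: eq)+
  then show ?thesis by (simp add: eq)
qed

lemma ptime_le [ptime_intros]: "ptime f \<Longrightarrow> ptime g \<Longrightarrow> ptime (\<lambda>x. f x \<le> (g x :: nat))"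
  unfolding diff_is_0_eq[symmetric] by (intro ptime_intros)

lemma ptime_conj [ptime_intros]:
  assumes "ptime f" "ptime g"
  shows "ptime (\<lambda>x. f x \<and> g x)"
proof -
  have "ptime (\<lambda>x. if f x then g x else False)" by (intro ptime_intros assms)
  moreover have "(if a then b else False) = (a \<and> b)" for a b by simp
  ultimately show ?thesis by (simp only:)
qed

lemma ptime_not [ptime_intros]:
  assumes "ptime f"
  shows "ptime (\<lambda>x. \<not> f x)"
proof -
  have "ptime (\<lambda>x. if f x then False else True)" by (intro ptime_intros assms)
  moreover have "(if a then False else True) = (\<not> a)" for a by simp
  ultimately show ?thesis by (simp only:)
qed

lemma ptime_disj [ptime_intros]:
  assumes "ptime f" "ptime g"
  shows "ptime (\<lambda>x. f x \<or> g x)"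
proof -
  have "ptime (\<lambda>x. if f x then True else g x)" by (intro ptime_intros assms)
  moreover have "(if a then True else b) = (a \<or> b)" for a b by simp
  ultimately show ?thesis by (simp only:)
qed

lemma ptime_iff [ptime_intros]:
  assumes "ptime f" "ptime g"
  shows "ptime (\<lambda>x. f x = (g x :: bool))"
proof -
  have "ptime (\<lambda>x. if f x then g x else \<not> g x)" by (intro ptime_intros assms)
  moreover have "(if a then b else \<not> b) = (a = b)" for a b by simp
  ultimately show ?thesis by (simp only:)
qed

lemma ptime_nat_eq [ptime_intros]:
  "ptime f \<Longrightarrow> ptime g \<Longrightarrow> ptime (\<lambda>x. f x = (g x :: nat))"
  unfolding order_eq_iff[where 'a = nat] by (intro ptime_intros)

lemma ptime_div_mod:
  assumes "ptime f" "ptime g"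
  shows "ptime (\<lambda>x. (f x div g x, f x mod g x :: nat))"
proof -
  \<comment> \<open>Counts up while carrying quotient and remainder. For \<open>n = 0\<close> there
    is never a carry, in agreement with \<open>m div 0 = 0\<close> and
    \<open>m mod 0 = m\<close>.\<close>
  define h where "h n s = (if Suc (snd s) = n then (Suc (fst s), 0) else (fst s, Suc (snd s)))"
    for n :: nat and s :: "nat \<times> nat"
  have eq: "(h n ^^ m) (0, 0) = (m div n, m mod n)" for m n
    by (induction m) (auto simp: h_def div_Suc mod_Suc)
  have "ptime (\<lambda>x. (h (g x) ^^ f x) (0, 0))"
  proof (rule ptime_funpow[where B = "\<lambda>x. f x + f x + 1"])
    show "ptime (\<lambda>p :: 'a \<times> nat \<times> nat. h (g (fst p)) (snd p))"
      unfolding h_def by (intro ptime_intros ptime_comp[OF assms(2)])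
    show "esize ((h (g x) ^^ k) (0, 0)) \<le> f x + f x + 1" if "k \<le> f x" for x k
    proof -
      have "k div g x \<le> k" "k mod g x \<le> k" by simp_all
      then have "k div g x + k mod g x \<le> f x + f x" using that by linarith
      then show ?thesis by (simp add: eq)
    qed
  qed (intro ptime_intros assms pbounded_add pbounded_const assms[THEN ptime_nat_pbounded])+
  then show ?thesis by (simp add: eq)
qed

lemma ptime_div [ptime_intros]: "ptime f \<Longrightarrow> ptime g \<Longrightarrow> ptime (\<lambda>x. f x div g x :: nat)"
  using ptime_fst[OF ptime_div_mod] by simp

lemma ptime_mod [ptime_intros]: "ptime f \<Longrightarrow> ptime g \<Longrightarrow> ptime (\<lambda>x. f x mod g x :: nat)"
  using ptime_snd[OF ptime_div_mod] by simp

lemma bit_eq_funpow: "bit (i::nat) j \<longleftrightarrow> odd (((\<lambda>a. a div 2) ^^ j) i)"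
  by (induction j arbitrary: i) (simp_all add: bit_0 bit_Suc funpow_Suc_right del: funpow.simps(2))

lemma ptime_bit [ptime_intros]:
  assumes "ptime f" "ptime g"
  shows "ptime (\<lambda>x. bit (f x :: nat) (g x))"
proof -
  have le: "((\<lambda>a. a div 2) ^^ k) i \<le> i" for k and i :: nat
    by (induction k) (auto intro: le_trans[OF div_le_dividend])
  have "ptime (\<lambda>x. ((\<lambda>a. a div 2) ^^ g x) (f x))"
    by (rule ptime_funpow[where B = f])
      (intro ptime_intros assms assms[THEN ptime_nat_pbounded] | simp add: le)+
  then show ?thesis unfolding bit_eq_funpow odd_iff_mod_2_eq_one by (intro ptime_intros)
qed

section \<open>Functions on lists\<close>

lemma foldl_Cons_eq: "foldl (\<lambda>s a. a # s) ys xs = rev xs @ ys"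
  by (induction xs arbitrary: ys) auto

lemma ptime_rev [ptime_intros]:
  assumes "ptime l"
  shows "ptime (\<lambda>x. rev (l x))"
proof -
  have "ptime (\<lambda>x. foldl (\<lambda>s a. a # s) [] (l x))"
    by (rule ptime_foldl[OF assms, where B = "\<lambda>x. esize (l x)"])
      (intro ptime_intros ptime_esize assms | simp add: esize_append foldl_Cons_eq)+
  then show ?thesis by (simp add: foldl_Cons_eq)
qed

lemma ptime_append [ptime_intros]:
  assumes "ptime f" "ptime g"
  shows "ptime (\<lambda>x. f x @ g x)"
proof -
  have "ptime (\<lambda>x. foldl (\<lambda>s a. a # s) (g x) (rev (f x)))"
  proof (rule ptime_foldl[where B = "\<lambda>x. esize (f x) + esize (g x)"])
    fix x ys zs assume "rev (f x) = ys @ zs"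
    then have "esize (f x) = esize ys + esize zs" by (metis esize_append esize_rev)
    then show "esize (foldl (\<lambda>s a. a # s) (g x) ys) \<le> esize (f x) + esize (g x)"
      by (simp add: foldl_Cons_eq esize_append)
  qed (intro ptime_intros pbounded_add ptime_esize assms)+
  then show ?thesis by (simp add: foldl_Cons_eq)
qed

lemma esize_concat_le: "esize (concat xss) \<le> esize xss"
  by (induction xss) (auto simp: esize_append)

lemma ptime_concat [ptime_intros]:
  assumes "ptime l"
  shows "ptime (\<lambda>x. concat (l x))"
proof -
  have eq: "foldl (@) ys xss = ys @ concat xss" for ys :: "'b list" and xss
    by (induction xss arbitrary: ys) auto
  have "ptime (\<lambda>x. foldl (@) [] (l x))"
  proof (rule ptime_foldl[OF assms, where B = "\<lambda>x. esize (l x)"])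
    fix x ys zs assume "l x = ys @ zs"
    then show "esize (foldl (@) [] ys) \<le> esize (l x)"
      using esize_concat_le[of ys] by (simp add: eq esize_append)
  qed (intro ptime_intros ptime_esize assms)+
  then show ?thesis by (simp add: eq)
qed

text \<open>\<open>h\<close> also receives the outer argument \<open>x\<close>, which covers nested
  maps whose functions depend on outer variables, as in \<open>clause_pairs\<close>.\<close>

lemma ptime_map [ptime_intros]:
  assumes "ptime l" "ptime (\<lambda>p. h (fst p) (snd p))"
  shows "ptime (\<lambda>x. map (h x) (l x))"
proof -
  have eq: "foldl (\<lambda>s a. h x a # s) zs ys = rev (map (h x) ys) @ zs" for x ys zs
    by (induction ys arbitrary: zs) auto
  obtain d :: nat where d: "\<And>p. esize (h (fst p) (snd p)) \<le> (esize p + 2) ^ d"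
    using ptime_esize[OF assms(2)] unfolding pbounded_def by blast
  \<comment> \<open>A member \<open>b\<close> of the list is smaller than the list, so
    \<open>esize (x, b) + 2\<close> stays below the base of this power.\<close>
  define B where "B x = esize (l x) * ((esize x + esize (l x) + 3) ^ d + 1)" for x
  have "ptime (\<lambda>x. foldl (\<lambda>s a. h x a # s) [] (l x))"
  proof (rule ptime_foldl[OF assms(1), where B = B])
    have "ptime (\<lambda>p :: 'a \<times> 'c list \<times> 'b. (\<lambda>q. h (fst q) (snd q)) (fst p, snd (snd p)))"
      by (rule ptime_comp[OF assms(2)]) (intro ptime_intros)
    then have "ptime (\<lambda>p :: 'a \<times> 'c list \<times> 'b. h (fst p) (snd (snd p)))" by simp
    then show "ptime (\<lambda>p :: 'a \<times> 'c list \<times> 'b. h (fst p) (snd (snd p)) # fst (snd p))"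
      by (intro ptime_intros)
    show "pbounded B" unfolding B_def
      by (intro pbounded_mult pbounded_add pbounded_power pbounded_const pbounded_esize
          ptime_esize[OF assms(1)])
    fix x ys zs assume l: "l x = ys @ zs"
    have "esize a \<le> (esize x + esize (l x) + 3) ^ d" if a: "a \<in> set (rev (map (h x) ys))" for a
    proof -
      obtain b where b: "b \<in> set ys" "a = h x b" using a by auto
      then have "esize b < esize (l x)" using l by (intro esize_member) simp
      then have "(esize (x, b) + 2) ^ d \<le> (esize x + esize (l x) + 3) ^ d"
        by (intro power_mono) auto
      then show ?thesis using d[of "(x, b)"] b(2) by simp
    qed
    from esize_list_le[of "rev (map (h x) ys)", OF this]
    have "esize (rev (map (h x) ys)) \<le> length ys * ((esize x + esize (l x) + 3) ^ d + 1)" by simp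
    also have "\<dots> \<le> B x" unfolding B_def
      using length_le_esize[of ys] by (intro mult_le_mono1) (simp add: l esize_append)
    finally show "esize (foldl (\<lambda>s a. h x a # s) [] ys) \<le> B x" by (simp add: eq)
  qed (intro ptime_intros)
  from ptime_rev[OF this] show ?thesis by (simp add: eq)
qed

lemma ptime_upt [ptime_intros]:
  assumes "ptime n"
  shows "ptime (\<lambda>x. [0..<n x])"
proof -
  define h where "h s = (Suc (fst s), snd s @ [fst s])" for s :: "nat \<times> nat list"
  have eq: "(h ^^ k) (0, []) = (k, [0..<k])" for k
    by (induction k) (auto simp: h_def)
  have "ptime (\<lambda>x. (h ^^ n x) (0, []))"
  proof (rule ptime_funpow[OF assms, where B = "\<lambda>x. n x + n x * (n x + 1) + 1"])
    show "ptime (\<lambda>p :: 'a \<times> nat \<times> nat list. h (snd p))"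
      unfolding h_def by (intro ptime_intros)
    fix x k assume k: "k \<le> n x"
    have "esize [0..<k] \<le> length [0..<k] * (n x + 1)"
      by (rule esize_list_le) (use k in auto)
    also have "\<dots> \<le> n x * (n x + 1)" using k by (intro mult_le_mono1) simp
    finally show "esize ((h ^^ k) (0, [])) \<le> n x + n x * (n x + 1) + 1"
      using k by (simp add: eq)
  qed (intro ptime_intros pbounded_add pbounded_mult pbounded_const ptime_nat_pbounded[OF assms])+
  then have "ptime (\<lambda>x. snd (n x, [0..<n x]))" unfolding eq by (rule ptime_snd)
  then show ?thesis by simp
qed


section \<open>The reduction\<close>

text \<open>The state \<open>(b, 2 ^ b)\<close> carries the power along and is tested before it is
  doubled. No component of a reached state exceeds \<open>N + 2\<close>, which keeps the search
  polynomial despite unary numbers.\<close>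

definition grow :: "nat \<Rightarrow> nat \<times> nat \<Rightarrow> nat \<times> nat" where
  "grow N s = (if 2 * snd s * Suc (fst s) * Suc (fst s) \<le> N then (Suc (fst s), 2 * snd s) else s)"

text \<open>\<open>blocks N = (b, 2 ^ b)\<close>, where \<open>b\<close> is the largest number with \<open>2 ^ b * b\<^sup>2 \<le> N\<close>, or \<open>1\<close>.\<close>

definition blocks :: "nat \<Rightarrow> nat \<times> nat" where
  "blocks N = (grow N ^^ N) (1, 2)"

text \<open>The last disjunct says that the state has grown in each of the \<open>k\<close> rounds
  or is already stationary.\<close>

lemma funpow_grow:
  fixes N k :: nat
  defines "s \<equiv> (grow N ^^ k) (1, 2)"
  shows "snd s = 2 ^ fst s \<and> 1 \<le> fst s \<and> (fst s = 1 \<or> snd s * fst s * fst s \<le> N) \<and>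
    (fst s = Suc k \<or> grow N s = s)"
  unfolding s_def
proof (induction k)
  case (Suc k)
  define s where "s = (grow N ^^ k) (1, 2)"
  show ?case
  proof (cases "grow N s = s")
    case True
    then have eq: "(grow N ^^ Suc k) (1, 2) = s" unfolding s_def by simp
    show ?thesis unfolding eq using Suc True unfolding s_def[symmetric] by blast
  next
    case False
    then have "2 * snd s * Suc (fst s) * Suc (fst s) \<le> N" "grow N s = (Suc (fst s), 2 * snd s)"
      unfolding grow_def by (auto split: if_splits)
    moreover have "(grow N ^^ Suc k) (1, 2) = grow N s" unfolding s_def by simp
    ultimately show ?thesis using Suc False unfolding s_def[symmetric] by simp
  qed
qed simp

lemma blocks_facts:
  shows "snd (blocks N) = 2 ^ fst (blocks N)" "1 \<le> fst (blocks N)"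
    "fst (blocks N) = 1 \<or> snd (blocks N) * fst (blocks N) * fst (blocks N) \<le> N"
  using funpow_grow[where N = N and k = N] unfolding blocks_def by blast+

text \<open>\<open>N\<close> rounds suffice: a state that still grows after them has first component
  \<open>Suc N\<close>, which makes the right-hand side exceed \<open>N\<close>, against the success
  of the test.\<close>

lemma blocks_maximal: "N < 2 * snd (blocks N) * Suc (fst (blocks N)) * Suc (fst (blocks N))"
proof (rule ccontr)
  let ?s = "blocks N"
  assume *: "\<not> ?thesis"
  then have "grow N ?s \<noteq> ?s" unfolding grow_def by (auto simp: prod_eq_iff)
  then have b: "fst ?s = Suc N" using funpow_grow[where N = N and k = N] unfolding blocks_def by blast
  have "1 * 1 * N \<le> 2 * snd ?s * Suc (fst ?s) * N" using blocks_facts(1)[of N] by (intro mult_le_mono) auto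
  also have "\<dots> < 2 * snd ?s * Suc (fst ?s) * Suc (fst ?s)"
    unfolding b using blocks_facts(1)[of N] by (intro mult_strict_left_mono) auto
  finally show False using * by simp
qed

lemma ptime_blocks [ptime_intros]:
  assumes "ptime f"
  shows "ptime (\<lambda>x. blocks (f x))"
  unfolding blocks_def
proof (rule ptime_funpow[where B = "\<lambda>x. f x + f x + 5"])
  show "ptime (\<lambda>p :: 'a \<times> nat \<times> nat. grow (f (fst p)) (snd p))"
    unfolding grow_def by (intro ptime_intros ptime_comp[OF assms])
  fix x k
  define s where "s = (grow (f x) ^^ k) (1, 2)"
  have s: "snd s = 2 ^ fst s" "1 \<le> fst s" "fst s = 1 \<or> snd s * fst s * fst s \<le> f x"
    using funpow_grow[where N = "f x" and k = k] unfolding s_def by blast+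
  have "fst s < snd s" unfolding s by (rule less_exp)
  moreover have "snd s \<le> f x + 2"
  proof (cases "fst s = 1")
    case False
    have "snd s * 1 * 1 \<le> snd s * fst s * fst s" using s(2) by (intro mult_le_mono) auto
    then show ?thesis using False s(3) by linarith
  qed (use s in simp)
  moreover have "esize s = fst s + snd s + 1" by (simp add: enc_prod_def)
  ultimately have "esize s \<le> f x + f x + 5" by linarith
  then show "esize ((grow (f x) ^^ k) (1, 2)) \<le> f x + f x + 5" unfolding s_def .
qed (intro ptime_intros assms pbounded_add pbounded_const ptime_nat_pbounded[OF assms])+

text \<open>The components say whether an equal pair has been seen, whether the last entry opened a
  pair, and what the last entry was. Pairs are disjoint, so equality across a boundary between pairs
  does not count.\<close>

definition pair_step :: "bool \<times> bool \<times> nat \<Rightarrow> nat \<Rightarrow> bool \<times> bool \<times> nat" where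
  "pair_step s a = (fst s \<or> fst (snd s) \<and> snd (snd s) = a, \<not> fst (snd s), a)"

definition has_equal_pair :: "nat list \<Rightarrow> bool" where
  "has_equal_pair xs \<longleftrightarrow> fst (foldl pair_step (False, False, 0) xs)"

lemma has_equal_pair_concat:
  "has_equal_pair (concat (map (\<lambda>p. [f p, g p]) ps)) \<longleftrightarrow> (\<exists>p\<in>set ps. f p = g p)"
proof -
  have "fst (foldl pair_step (c, False, a) (concat (map (\<lambda>p. [f p, g p]) ps))) \<longleftrightarrow>
      c \<or> (\<exists>p\<in>set ps. f p = g p)" for c a
    by (induction ps arbitrary: c a) (auto simp: pair_step_def)
  then show ?thesis by (simp add: has_equal_pair_def)
qed

lemma ptime_has_equal_pair: "ptime has_equal_pair"
proof -
  have "ptime (\<lambda>xs :: nat list. foldl pair_step (False, False, 0) xs)"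
  proof (rule ptime_foldl[where B = "\<lambda>xs. esize xs + 4"])
    show "ptime (\<lambda>p :: nat list \<times> (bool \<times> bool \<times> nat) \<times> nat. pair_step (fst (snd p)) (snd (snd p)))"
      unfolding pair_step_def by (intro ptime_intros)
    fix xs ys zs :: "nat list" assume xs: "xs = ys @ zs"
    define s where "s = foldl pair_step (False, False, 0) ys"
    \<comment> \<open>The remembered entry is 0 or occurs in the list, which bounds the
      accumulator.\<close>
    have "snd (snd s) \<in> insert 0 (set ys)"
      unfolding s_def by (induction ys rule: rev_induct) (auto simp: pair_step_def)
    then have "snd (snd s) \<le> esize xs"
      using esize_member[of "snd (snd s)" xs] xs by auto
    moreover have "esize (c::bool) \<le> 1" for c by (cases c) auto
    then have "esize (fst s) \<le> 1" "esize (fst (snd s)) \<le> 1" by blast+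
    ultimately show "esize s \<le> esize xs + 4" by (simp add: enc_prod_def)
  qed (intro ptime_intros pbounded_add pbounded_const pbounded_esize)+
  then show ?thesis unfolding has_equal_pair_def by (rule ptime_fst)
qed

text \<open>The literal on variable \<open>v\<close> holds iff the user of the step of its block is that of an anchor
  \<open>i\<close> whose bit \<open>v mod b\<close> has the right value.\<close>

definition clause_pairs :: "nat \<Rightarrow> nat \<Rightarrow> literal list \<Rightarrow> (nat \<times> nat) list" where
  "clause_pairs b r cl = concat (map (\<lambda>l. concat (map (\<lambda>i.
     if bit i (fst l mod b) = snd l then [(r + fst l div b, i)] else []) [0..<r])) cl)"

definition clause_scope :: "nat \<Rightarrow> nat \<Rightarrow> literal list \<Rightarrow> nat list" where
  "clause_scope b r cl = concat (map (\<lambda>p. [fst p, snd p]) (clause_pairs b r cl))"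

text \<open>Steps below \<open>snd (blocks N)\<close> are the anchors, the others the blocks.
  \<open>Suc (N div b)\<close> blocks contain all variables below \<open>N\<close> whether or not
  \<open>b\<close> divides \<open>N\<close>.\<close>

definition reduction :: "com \<Rightarrow> nat \<Rightarrow> cnf \<Rightarrow> wsp_input" where
  "reduction Q N \<phi> = \<lparr>
     num_steps = snd (blocks N) + Suc (N div fst (blocks N)),
     num_users = snd (blocks N),
     auth_lists = map (\<lambda>i. [i]) [0..<snd (blocks N)] @
       map (\<lambda>_. [0..<snd (blocks N)]) [0..<Suc (N div fst (blocks N))],
     checkers = map (\<lambda>cl. (clause_scope (fst (blocks N)) (snd (blocks N)) cl, Q)) \<phi>\<rparr>"

lemma set_clause_pairs:
  "set (clause_pairs b r cl) =
     {(r + v div b, i) | v \<beta> i. (v, \<beta>) \<in> set cl \<and> i < r \<and> bit i (v mod b) = \<beta>}"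
  unfolding clause_pairs_def by (force split: if_splits)

lemma set_clause_scope:
  "set (clause_scope b r cl) =
     fst ` set (clause_pairs b r cl) \<union> snd ` set (clause_pairs b r cl)"
  unfolding clause_scope_def by auto

lemma enc_assignment_eq: "enc_assignment ss \<theta> = enc (map \<theta> ss)"
  by (simp add: enc_assignment_def enc_list_def enc_nat_def comp_def)

lemma enc_cnf_eq: "enc_cnf N \<phi> = enc (N, \<phi>)"
proof -
  have "enc_literal = enc" by (auto simp: enc_literal_def enc_prod_def enc_nat_def enc_bool_def)
  then show ?thesis
    by (simp add: enc_cnf_def comp_def flip: enc_list_def enc_nat_def)
qed

text \<open>The final \<open>[]\<close> supplies the \<open>Leaf\<close> that closes the list of
  four trees in \<open>enc_input\<close>. A tuple is used because the components have different
  types.\<close>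

lemma enc_input_eq:
  "enc_input I = enc (num_steps I, num_users I, auth_lists I, checkers I, [] :: nat list)"
proof -
  have "(\<lambda>(ss, P). Node (enc_list (map enc_nat ss)) (enc_com P)) = enc"
    by (auto simp: enc_list_def enc_nat_def enc_com_def)
  then show ?thesis unfolding enc_input_def
    by (simp add: enc_input_def comp_def flip: enc_list_def enc_nat_def)
qed

lemma ptime_reduction:
  "ptime (\<lambda>x. (num_steps (reduction Q (fst x) (snd x)), num_users (reduction Q (fst x) (snd x)),
     auth_lists (reduction Q (fst x) (snd x)), checkers (reduction Q (fst x) (snd x)), [] :: nat list))"
  unfolding reduction_def wsp_input.select_convs clause_scope_def clause_pairs_def
  by (intro ptime_intros)

section \<open>Correctness of the reduction\<close>

context
  fixes Q :: com and t N :: nat and \<phi> :: cnf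
  assumes Q: "\<And>xs :: nat list. accepts Q (enc xs) \<longleftrightarrow> has_equal_pair xs"
    and \<phi>: "is_tcnf t N \<phi>"
begin

private abbreviation (input) "b \<equiv> fst (blocks N)"
private abbreviation (input) "r \<equiv> snd (blocks N)"
private abbreviation (input) "I \<equiv> reduction Q N \<phi>"

lemma constraint_of_clause:
  "constraint_of n (clause_scope c d cl, Q) = (set (clause_scope c d cl),
     {\<theta> \<in> set (clause_scope c d cl) \<rightarrow>\<^sub>E {..<n}. \<exists>(s, i) \<in> set (clause_pairs c d cl). \<theta> s = \<theta> i})"
proof -
  have "accepts Q (enc_assignment (clause_scope c d cl) \<theta>) \<longleftrightarrow>
      (\<exists>(s, i) \<in> set (clause_pairs c d cl). \<theta> s = \<theta> i)" for \<theta>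
    unfolding enc_assignment_eq Q clause_scope_def
    using has_equal_pair_concat[of "\<lambda>p. \<theta> (fst p)" "\<lambda>p. \<theta> (snd p)"]
    by (simp add: map_concat comp_def case_prod_unfold)
  then show ?thesis by (simp add: constraint_of_def)
qed

lemma Constraints_reduction:
  "Constraints (workflow_of I) = (\<lambda>cl. (set (clause_scope b r cl),
     {\<theta> \<in> set (clause_scope b r cl) \<rightarrow>\<^sub>E {..<r}.
       \<exists>(s, i) \<in> set (clause_pairs b r cl). \<theta> s = \<theta> i})) ` set \<phi>"
  by (simp add: workflow_of_def reduction_def constraint_of_clause image_image)

lemma workflow_of_reduction [simp]:
  "Steps (workflow_of I) = {..<r + Suc (N div b)}"
  "Users (workflow_of I) = {..<r}"
  by (simp_all add: workflow_of_def reduction_def)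

lemma Auth_reduction:
  "s < r + Suc (N div b) \<Longrightarrow> Auth (workflow_of I) s = (if s < r then {s} else {..<r})"
  by (auto simp: workflow_of_def reduction_def nth_append atLeast0LessThan simp del: upt_Suc)

lemma clause_pairs_bound:
  assumes "cl \<in> set \<phi>" "(s, i) \<in> set (clause_pairs b r cl)"
  shows "r \<le> s" "s < r + Suc (N div b)" "i < r"
  using assms \<phi> unfolding set_clause_pairs is_tcnf_def
  by (fastforce intro: div_le_mono less_imp_le simp: less_Suc_eq_le)+

lemma valid_input_reduction: "valid_input I"
proof -
  have "set (clause_scope b r cl) \<subseteq> {..<r + Suc (N div b)}" if "cl \<in> set \<phi>" for cl
    using clause_pairs_bound[OF that] unfolding set_clause_scope by fastforce
  then have "workflow (workflow_of I)"
    unfolding workflow_def Constraints_reduction by (auto simp: Auth_reduction)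
  then show ?thesis by (simp add: valid_input_def reduction_def)
qed

text \<open>Membership is a disjunction of equations between the users of two steps. Applying
  \<open>\<psi>\<close> to both sides preserves an equation, and bijectivity keeps the values among
  the users.\<close>

lemma user_independent_reduction:
  assumes "c \<in> Constraints (workflow_of I)"
  shows "user_independent (Users (workflow_of I)) c"
proof -
  obtain cl where cl: "c = (set (clause_scope b r cl),
     {\<theta> \<in> set (clause_scope b r cl) \<rightarrow>\<^sub>E {..<r}.
       \<exists>(s, i) \<in> set (clause_pairs b r cl). \<theta> s = \<theta> i})"
    using assms unfolding Constraints_reduction by blast
  let ?T = "set (clause_scope b r cl)" and ?p = "clause_pairs b r cl"
  have "\<exists>(s, i) \<in> set ?p. restrict (\<psi> \<circ> \<theta>) ?T s = restrict (\<psi> \<circ> \<theta>) ?T i"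
    if ex: "\<exists>(s, i) \<in> set ?p. \<theta> s = \<theta> i" for \<theta> and \<psi> :: "nat \<Rightarrow> nat"
  proof -
    obtain s i where si: "(s, i) \<in> set ?p" "\<theta> s = \<theta> i" using ex by auto
    then have "s \<in> ?T" "i \<in> ?T" unfolding set_clause_scope by force+
    then show ?thesis using si by (intro bexI[of _ "(s, i)"]) auto
  qed
  moreover have "restrict (\<psi> \<circ> \<theta>) ?T \<in> ?T \<rightarrow>\<^sub>E {..<r}"
    if "bij_betw \<psi> {..<r} {..<r}" "\<theta> \<in> ?T \<rightarrow>\<^sub>E {..<r}" for \<theta> \<psi>
    using that bij_betwE by fastforce
  ultimately show ?thesis unfolding user_independent_def cl workflow_of_reduction by blast
qed

text \<open>Both steps of a pair lie in the scope, so restricting the plan to the scope does not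
  affect the equation.\<close>

lemma eligible_reduction:
  "eligible (workflow_of I) \<pi> \<longleftrightarrow> (\<forall>cl\<in>set \<phi>.
     restrict \<pi> (set (clause_scope b r cl)) \<in> set (clause_scope b r cl) \<rightarrow>\<^sub>E {..<r} \<and>
     (\<exists>(s, i) \<in> set (clause_pairs b r cl). \<pi> s = \<pi> i))"
proof -
  have "(\<exists>(s, i) \<in> set (clause_pairs b r cl). restrict \<pi> (set (clause_scope b r cl)) s =
        restrict \<pi> (set (clause_scope b r cl)) i) \<longleftrightarrow>
      (\<exists>(s, i) \<in> set (clause_pairs b r cl). \<pi> s = \<pi> i)" for cl
    by (rule bex_cong[OF refl]) (auto simp: set_clause_scope image_iff split: prod.splits; force)
  then show ?thesis unfolding eligible_def Constraints_reduction by simp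
qed

lemma wsp_satisfiable_reduction: "wsp_satisfiable (workflow_of I) \<longleftrightarrow> cnf_satisfiable \<phi>"
proof
  assume "wsp_satisfiable (workflow_of I)"
  then obtain \<pi> where auth: "authorized (workflow_of I) \<pi>" and el: "eligible (workflow_of I) \<pi>"
    unfolding wsp_satisfiable_def by blast
  \<comment> \<open>The anchor of user \<open>i\<close> admits only \<open>i\<close>, so every
    authorized plan fixes it.\<close>
  have id: "\<pi> i = i" if "i < r" for i
  proof -
    have "i \<in> Steps (workflow_of I)" using that by simp
    then have "\<pi> i \<in> Auth (workflow_of I) i" using auth unfolding authorized_def by blast
    then show ?thesis using that Auth_reduction[of i] by simp
  qed
  \<comment> \<open>The binary digits of the user of a block are the values of its
    variables.\<close>
  define \<alpha> where "\<alpha> v = bit (\<pi> (r + v div b)) (v mod b)" for v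
  have "\<exists>(v, \<beta>) \<in> set cl. \<alpha> v = \<beta>" if cl: "cl \<in> set \<phi>" for cl
  proof -
    obtain s i where si: "(s, i) \<in> set (clause_pairs b r cl)" and "\<pi> s = \<pi> i"
      using el cl unfolding eligible_reduction by blast
    moreover obtain v \<beta> where "(v, \<beta>) \<in> set cl" "s = r + v div b" "i < r" "bit i (v mod b) = \<beta>"
      using si unfolding set_clause_pairs by blast
    ultimately have "(v, \<beta>) \<in> set cl" "\<alpha> v = \<beta>" unfolding \<alpha>_def using id by simp_all
    then show ?thesis by blast
  qed
  then show "cnf_satisfiable \<phi>" unfolding cnf_satisfiable_def by blast
next
  assume "cnf_satisfiable \<phi>"
  then obtain \<alpha> where \<alpha>: "\<And>cl. cl \<in> set \<phi> \<Longrightarrow> \<exists>(v, \<beta>) \<in> set cl. \<alpha> v = \<beta>"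
    unfolding cnf_satisfiable_def by blast
  let ?k = "r + Suc (N div b)"
  \<comment> \<open>Conversely, the values in block \<open>j\<close> are the binary digits of a
    number below \<open>2 ^ b\<close>, hence of a user. The last block may reach beyond
    \<open>N\<close>, where \<open>\<alpha>\<close> has values as well.\<close>
  define code :: "nat \<Rightarrow> nat"
    where "code j = horner_sum of_bool 2 (map (\<lambda>l. \<alpha> (j * b + l)) [0..<b])" for j
  have code: "code j < r" for j
    unfolding code_def blocks_facts(1)
    using horner_sum_of_bool_2_less[of "map (\<lambda>l. \<alpha> (j * b + l)) [0..<b]"] by simp
  have b: "0 < b" using blocks_facts(2)[of N] by simp
  have bit: "bit (code (v div b)) (v mod b) = \<alpha> v" for v
    unfolding code_def bit_horner_sum_bit_iff using b by simp
  define \<pi> where "\<pi> = (\<lambda>s \<in> {..<?k}. if s < r then s else code (s - r))"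
  have \<pi>: "\<pi> \<in> {..<?k} \<rightarrow>\<^sub>E {..<r}" unfolding \<pi>_def using code by auto
  have "authorized (workflow_of I) \<pi>"
    unfolding authorized_def using code by (auto simp: Auth_reduction \<pi>_def)
  moreover have "eligible (workflow_of I) \<pi>"
    unfolding eligible_reduction
  proof (intro ballI conjI)
    fix cl assume cl: "cl \<in> set \<phi>"
    let ?T = "set (clause_scope b r cl)"
    have "?T \<subseteq> {..<?k}"
      using clause_pairs_bound[OF cl] unfolding set_clause_scope by fastforce
    then show "restrict \<pi> ?T \<in> ?T \<rightarrow>\<^sub>E {..<r}" using \<pi> by fastforce
    obtain v where v: "(v, \<alpha> v) \<in> set cl" using \<alpha>[OF cl] by auto
    let ?s = "r + v div b" and ?i = "code (v div b)"
    \<comment> \<open>A true literal contributes its block paired with every anchor whose bit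
      matches. The anchor numbered by the code of the block is among them, and the plan gives both
      the same user.\<close>
    have p: "(?s, ?i) \<in> set (clause_pairs b r cl)"
      unfolding set_clause_pairs using v code bit by blast
    moreover have "\<pi> ?s = \<pi> ?i"
      using clause_pairs_bound[OF cl p] by (simp add: \<pi>_def)
    ultimately show "\<exists>(s, i) \<in> set (clause_pairs b r cl). \<pi> s = \<pi> i" by blast
  qed
  ultimately show "wsp_satisfiable (workflow_of I)"
    unfolding wsp_satisfiable_def workflow_of_reduction using \<pi> by blast
qed

end


section \<open>Size of the constructed instance\<close>

abbreviation steps :: "nat \<Rightarrow> nat" where
  "steps N \<equiv> snd (blocks N) + Suc (N div fst (blocks N))"

lemma reduction_simps:
  "num_steps (reduction Q N \<phi>) = steps N"
  "num_users (reduction Q N \<phi>) = snd (blocks N)"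
  "length (checkers (reduction Q N \<phi>)) = length \<phi>"
  by (simp_all add: reduction_def)

text \<open>Clauses do not repeat, so there are at most as many as lists of length at most
  \<open>t\<close> over \<open>2 * N\<close> literals. The base \<open>2 * N + 1\<close> is positive
  even for \<open>N = 0\<close>, so its powers increase with the exponent.\<close>

lemma length_tcnf_le:
  assumes "is_tcnf t N \<phi>"
  shows "length \<phi> \<le> (t + 1) * (2 * N + 1) ^ t"
proof -
  let ?L = "{..<N} \<times> (UNIV :: bool set)"
  have "length \<phi> = card (set \<phi>)" using assms by (simp add: is_tcnf_def distinct_card)
  also have "\<dots> \<le> card {xs. set xs \<subseteq> ?L \<and> length xs \<le> t}"
    by (rule card_mono) (use assms in \<open>auto simp: is_tcnf_def intro!: finite_lists_length_le\<close>)
  also have "\<dots> = (\<Sum>i\<le>t. card ?L ^ i)" by (rule card_lists_length_le) simp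
  also have "\<dots> \<le> (\<Sum>i\<le>t. (2 * N + 1) ^ t)"
  proof (rule sum_mono)
    fix i assume "i \<in> {..t}"
    then have "(2 * N + 1) ^ i \<le> (2 * N + 1) ^ t" by (intro power_increasing) auto
    moreover have "card ?L ^ i \<le> (2 * N + 1) ^ i" by (intro power_mono) (auto simp: card_cartesian_product)
    ultimately show "card ?L ^ i \<le> (2 * N + 1) ^ t" by linarith
  qed
  finally show ?thesis by simp
qed

lemma esize_tcnf_le:
  assumes "is_tcnf t N \<phi>"
  shows "esize (N, \<phi>) \<le> N + length \<phi> * (t * (N + 2) + 1) + 1"
proof -
  have "esize cl \<le> t * (N + 2)" if cl: "cl \<in> set \<phi>" for cl
  proof -
    have "esize l \<le> N + 1" if l: "l \<in> set cl" for l
    proof -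
      obtain v \<beta> where [simp]: "l = (v, \<beta>)" by force
      have "v < N" using assms cl l by (auto simp: is_tcnf_def)
      then show ?thesis by (cases \<beta>) auto
    qed
    from esize_list_le[of cl, OF this] have "esize cl \<le> length cl * (N + 2)" by simp
    also have "\<dots> \<le> t * (N + 2)" using assms cl by (intro mult_le_mono1) (auto simp: is_tcnf_def)
    finally show ?thesis .
  qed
  from esize_list_le[of \<phi>, OF this] show ?thesis by simp
qed

text \<open>Bounds for the instance must be polynomial in the numbers of users, steps and
  constraints, whereas the formula is measured in \<open>N\<close>; this controls \<open>N\<close>
  by the former. There are more than \<open>N / b\<close> blocks, and
  \<open>b < 2 ^ b\<close>.\<close>

lemma le_steps: "N \<le> snd (blocks N) * steps N"
proof -
  let ?b = "fst (blocks N)"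
  have "N = ?b * (N div ?b) + N mod ?b" by simp
  also have "\<dots> \<le> ?b * (N div ?b) + ?b"
    using blocks_facts(2)[of N] by (intro add_left_mono less_imp_le mod_less_divisor) simp
  also have "\<dots> = ?b * Suc (N div ?b)" by simp
  also have "\<dots> \<le> snd (blocks N) * steps N"
    unfolding blocks_facts(1) by (intro mult_le_mono less_imp_le[OF less_exp]) simp
  finally show ?thesis .
qed

definition volume :: "nat \<Rightarrow> cnf \<Rightarrow> nat" where
  "volume N \<phi> = snd (blocks N) + steps N + length \<phi> + 1"

lemma poly_bound_reduction: "poly_bound d (reduction Q N \<phi>) = d * volume N \<phi> ^ d"
  by (simp add: poly_bound_def reduction_simps volume_def)

lemma esize_le_volume:
  assumes "is_tcnf t N \<phi>"
  shows "esize (N, \<phi>) + 2 \<le> (3 * t + 6) * volume N \<phi> ^ 3"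
proof -
  let ?M = "volume N \<phi>"
  have M: "1 \<le> ?M" "length \<phi> \<le> ?M" "snd (blocks N) \<le> ?M" "steps N \<le> ?M"
    by (simp_all add: volume_def)
  have N: "N \<le> ?M\<^sup>2"
    using le_steps[of N] mult_le_mono[OF M(3,4)] unfolding power2_eq_square by linarith
  have M2: "1 \<le> ?M\<^sup>2" using M(1) by simp
  have M3: "?M\<^sup>2 \<le> ?M ^ 3" "1 \<le> ?M ^ 3" using M(1) by (auto intro: power_increasing)
  have "length \<phi> * (t * (N + 2) + 1) \<le> ?M * (t * (?M\<^sup>2 + 2 * ?M\<^sup>2) + ?M\<^sup>2)"
    using M(2) N M2 by (intro mult_le_mono add_le_mono) auto
  also have "\<dots> = (3 * t + 1) * ?M ^ 3" by (simp add: power2_eq_square power3_eq_cube algebra_simps)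
  finally have "length \<phi> * (t * (N + 2) + 1) \<le> (3 * t + 1) * ?M ^ 3" .
  then have "esize (N, \<phi>) + 2 \<le> ?M ^ 3 + (3 * t + 1) * ?M ^ 3 + 3 * ?M ^ 3"
    using esize_tcnf_le[OF assms] N M3 by linarith
  then show ?thesis by (simp add: algebra_simps)
qed

text \<open>In \<open>poly_bound d\<close> the number \<open>d\<close> is both factor and exponent,
  so it has to dominate a coefficient and an exponent at once.\<close>

lemma mult_power_mono:
  fixes a d e M :: nat
  assumes "1 \<le> M" "a \<le> d" "e \<le> d"
  shows "a * M ^ e \<le> d * M ^ d"
  using assms by (intro mult_le_mono power_increasing)

lemma poly_checkable_reduction:
  assumes R: "\<And>N \<phi>. size (enc_input (reduction Q N \<phi>)) \<le> (esize (N, \<phi>) + 2) ^ D"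
    and Q: "\<And>xs :: nat list. halts_within Q (enc xs) (real ((esize xs + 2) ^ D'))"
  shows "\<exists>d. \<forall>N \<phi>. is_tcnf t N \<phi> \<longrightarrow> poly_checkable d (reduction Q N \<phi>)"
proof (intro exI allI impI)
  fix N \<phi> assume \<phi>: "is_tcnf t N \<phi>"
  let ?M = "volume N \<phi>" and ?I = "reduction Q N \<phi>" and ?c = "(3 * t + 6) ^ D"
  \<comment> \<open>The sum of the coefficients and exponents of the two bounds below, one on the
    input size and one on the checking time. It depends on \<open>t\<close>, \<open>D\<close> and
    \<open>D'\<close> only.\<close>
  let ?d = "?c + 3 * D + (3 * ?c) ^ D' + (3 * D + 1) * D'"
  have M: "1 \<le> ?M" by (simp add: volume_def)
  have c: "1 \<le> ?c" by simp
  have "size (enc_input ?I) \<le> ((3 * t + 6) * ?M ^ 3) ^ D"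
    using R[of N \<phi>] power_mono[OF esize_le_volume[OF \<phi>], of D] by linarith
  then have S: "size (enc_input ?I) \<le> ?c * ?M ^ (3 * D)"
    by (simp add: power_mult_distrib power_mult)
  also have "\<dots> \<le> ?d * ?M ^ ?d" using M by (intro mult_power_mono) auto
  finally have "size (enc_input ?I) \<le> poly_bound ?d ?I" unfolding poly_bound_reduction .
  moreover have "halts_within P (enc_assignment ss \<theta>) (real (poly_bound ?d ?I))"
    if P: "(ss, P) \<in> set (checkers ?I)" and \<theta>: "\<theta> \<in> set ss \<rightarrow>\<^sub>E {..<num_users ?I}" for ss P \<theta>
  proof -
    have PQ: "P = Q" using P by (auto simp: reduction_def)
    \<comment> \<open>Scopes are listed with repetitions, so the number of steps does not bound
      their length. The list is part of the input, whose size is already bounded.\<close>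
    have "length ss \<le> esize ss" by (rule length_le_esize)
    also have "\<dots> \<le> esize (ss, P)" by simp
    also have "\<dots> \<le> esize (checkers ?I)" using esize_member[OF P] by simp
    also have "\<dots> \<le> size (enc_input ?I)" by (simp add: enc_input_eq)
    also note S
    finally have len: "length ss \<le> ?c * ?M ^ (3 * D)" .
    have "esize u \<le> snd (blocks N)" if u: "u \<in> set (map \<theta> ss)" for u
    proof -
      obtain s where "s \<in> set ss" "u = \<theta> s" using u by auto
      then show ?thesis using PiE_mem[OF \<theta>, of s] by (simp add: reduction_simps)
    qed
    from esize_list_le[of "map \<theta> ss", OF this]
    have "esize (map \<theta> ss) \<le> length ss * (snd (blocks N) + 1)" by simp
    also have "\<dots> \<le> (?c * ?M ^ (3 * D)) * ?M" using len by (intro mult_le_mono) (auto simp: volume_def)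
    also have "\<dots> = ?c * ?M ^ (3 * D + 1)" by simp
    finally have "esize (map \<theta> ss) + 2 \<le> 3 * (?c * ?M ^ (3 * D + 1))"
      using mult_le_mono[OF c one_le_power[OF M, of "3 * D + 1"]] by linarith
    then have "(esize (map \<theta> ss) + 2) ^ D' \<le> (3 * (?c * ?M ^ (3 * D + 1))) ^ D'"
      by (rule power_mono) simp
    also have "\<dots> = (3 * ?c) ^ D' * ?M ^ ((3 * D + 1) * D')"
      by (simp only: power_mult_distrib power_mult mult.assoc)
    also have "\<dots> \<le> ?d * ?M ^ ?d" using M by (intro mult_power_mono) auto
    finally have "(esize (map \<theta> ss) + 2) ^ D' \<le> poly_bound ?d ?I" unfolding poly_bound_reduction .
    then show ?thesis
      using Q[of "map \<theta> ss"] unfolding halts_within_def enc_assignment_eq PQ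
      by (meson of_nat_le_iff order_trans)
  qed
  ultimately show "poly_checkable ?d ?I" unfolding poly_checkable_def by blast
qed


section \<open>Running time\<close>

lemma decides_within_Seq:
  assumes "exec R (init_state x) t (init_state y)" "decides_within A y c B"
  shows "decides_within (Seq R A) x c (real t + B)"
proof -
  obtain u s where u: "exec A (init_state y) u s" "real u \<le> B"
    using assms(2) unfolding decides_within_def halts_within_def by blast
  have RA: "exec (Seq R A) (init_state x) (t + u) s" using exec_Seq assms(1) u(1) by blast
  then have "accepts (Seq R A) x \<longleftrightarrow> s 0 \<noteq> Leaf"
    unfolding accepts_def using exec_deterministic by blast
  moreover have "accepts A y \<longleftrightarrow> s 0 \<noteq> Leaf"
    unfolding accepts_def using exec_deterministic u(1) by blast
  moreover have "halts_within (Seq R A) x (real t + B)"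
    unfolding halts_within_def using RA u(2) by (intro exI[of _ "t + u"]) auto
  ultimately show ?thesis using assms(2) unfolding decides_within_def by blast
qed

section \<open>Asymptotics of the number of steps\<close>

lemma filterlim_blocks: "filterlim (\<lambda>N. fst (blocks N)) at_top at_top"
  unfolding filterlim_at_top
proof
  fix Z
  show "\<forall>\<^sub>F N in at_top. Z \<le> fst (blocks N)"
    using eventually_ge_at_top[of "2 * 2 ^ Z * Suc Z * Suc Z"]
  proof eventually_elim
    case (elim N)
    show ?case
    proof (rule ccontr)
      assume "\<not> ?thesis"
      then have "2 * snd (blocks N) * Suc (fst (blocks N)) * Suc (fst (blocks N))
          \<le> 2 * 2 ^ Z * Suc Z * Suc Z"
        unfolding blocks_facts(1) by (intro mult_le_mono power_increasing) auto
      then show False using elim blocks_maximal[of N] by linarith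
    qed
  qed
qed

text \<open>Relative to \<open>N\<close>, the three fractions bound the \<open>N div b\<close>
  blocks, the anchors and the one additional block. The last factor bounds the logarithm, because
  maximality of \<open>b\<close> gives \<open>N < 2 * 2 ^ b * (b + 1) ^ 2\<close>.\<close>

lemma steps_log_steps_le:
  fixes N :: nat
  defines "b \<equiv> real (fst (blocks N))"
  assumes "2 \<le> fst (blocks N)"
  shows "real (steps N) * log 2 (real (steps N)) \<le>
    real N * ((1 / b + 1 / b\<^sup>2 + 1 / 2 powr b) * (1 + b + 2 * log 2 (b + 1)))"
proof -
  have b: "b \<ge> 2" using assms by simp
  have r: "real (snd (blocks N)) = 2 powr b" unfolding b_def blocks_facts(1) by (simp add: powr_realpow)
  have "snd (blocks N) * fst (blocks N) * fst (blocks N) \<le> N" using blocks_facts(3)[of N] assms by auto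
  then have "real (snd (blocks N) * fst (blocks N) * fst (blocks N)) \<le> real N" by (rule of_nat_mono)
  then have rN: "2 powr b * b\<^sup>2 \<le> real N" by (simp add: r b_def[symmetric] power2_eq_square)
  have "2 powr b * 1 \<le> 2 powr b * b\<^sup>2" using b by (intro mult_left_mono) auto
  then have N1: "2 powr b \<le> real N" using rN by linarith
  moreover have p4: "4 \<le> 2 powr b" using powr_mono[of 2 b 2] b by simp
  ultimately have N4: "4 \<le> real N" by simp
  have "real (N div fst (blocks N)) \<le> real N / b" unfolding b_def by (rule of_nat_div_le_of_nat)
  moreover have "2 powr b \<le> real N / b\<^sup>2" using rN b by (simp add: field_simps)
  moreover have "1 \<le> real N / 2 powr b" using N1 by (simp add: field_simps)
  moreover have "real (steps N) = 2 powr b + 1 + real (N div fst (blocks N))" by (simp add: r)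
  ultimately have "real (steps N) \<le> real N / b + real N / b\<^sup>2 + real N / 2 powr b" by linarith
  then have k: "real (steps N) \<le> real N * (1 / b + 1 / b\<^sup>2 + 1 / 2 powr b)"
    by (simp add: algebra_simps)
  \<comment> \<open>For \<open>b\<close> at least 2 the fractions sum to at most 1/2 + 1/4 + 1/4. So
    there are at most \<open>N\<close> steps, and the logarithm may be estimated by that of
    \<open>N\<close>.\<close>
  have "1 / b \<le> 1 / 2" using b by (simp add: field_simps)
  moreover have "1 / b\<^sup>2 \<le> 1 / 4" using power_mono[of 2 b 2] b by (simp add: field_simps)
  moreover have "1 / 2 powr b \<le> 1 / 4" using p4 by (simp add: field_simps)
  ultimately have "1 / b + 1 / b\<^sup>2 + 1 / 2 powr b \<le> 1" by linarith
  then have "real (steps N) \<le> real N" using k mult_left_mono[of _ 1 "real N"] by fastforce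
  then have "log 2 (real (steps N)) \<le> log 2 (real N)" by (intro log_mono) auto
  also have "\<dots> \<le> log 2 (2 * 2 powr b * (b + 1)\<^sup>2)"
  proof (rule log_mono)
    have "real N \<le> real (2 * snd (blocks N) * Suc (fst (blocks N)) * Suc (fst (blocks N)))"
      using blocks_maximal[of N] by (intro of_nat_mono less_imp_le)
    then show "real N \<le> 2 * 2 powr b * (b + 1)\<^sup>2"
      by (simp add: r b_def[symmetric] power2_eq_square algebra_simps)
  qed (use N4 in auto)
  also have "\<dots> = 1 + b + 2 * log 2 (b + 1)"
    using b by (simp add: log_mult log_nat_power)
  finally have "log 2 (real (steps N)) \<le> 1 + b + 2 * log 2 (b + 1)" .
  moreover have "0 \<le> log 2 (real (steps N))" by (subst zero_le_log_cancel_iff) auto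
  ultimately have "real (steps N) * log 2 (real (steps N)) \<le>
      (real N * (1 / b + 1 / b\<^sup>2 + 1 / 2 powr b)) * (1 + b + 2 * log 2 (b + 1))"
    using k by (intro mult_mono) auto
  then show ?thesis by (simp add: mult.assoc)
qed

lemma eventually_steps_log_steps_le:
  assumes "1 < \<rho>"
  shows "\<forall>\<^sub>F N in at_top. real (steps N) * log 2 (real (steps N)) \<le> \<rho> * real N"
proof -
  let ?g = "\<lambda>b::nat. (1 / real b + 1 / (real b)\<^sup>2 + 1 / 2 powr real b) *
    (1 + real b + 2 * log 2 (real b + 1))"
  \<comment> \<open>The product of \<open>1 / b\<close> and \<open>b\<close> is 1; all other
    products vanish in the limit.\<close>
  have "?g \<longlonglongrightarrow> 1" by real_asymp
  then have "\<forall>\<^sub>F b in at_top. ?g b < \<rho>" using assms by (rule order_tendstoD)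
  then have "\<forall>\<^sub>F N in at_top. ?g (fst (blocks N)) < \<rho>"
    using filterlim_blocks by (rule eventually_compose_filterlim)
  moreover have "\<forall>\<^sub>F N in at_top. 2 \<le> fst (blocks N)"
    using filterlim_blocks unfolding filterlim_at_top by blast
  ultimately show ?thesis
  proof eventually_elim
    case (elim N)
    have "real N * ?g (fst (blocks N)) \<le> real N * \<rho>" using elim(1) by (intro mult_left_mono) auto
    then show ?case using steps_log_steps_le[OF elim(2)] by (simp add: mult.commute)
  qed
qed

text \<open>Half of the gap \<open>c' - c\<close> absorbs the polynomial factor, the other half the
  excess of \<open>k * log 2 k\<close> over \<open>N\<close>, where \<open>k\<close> is
  \<open>steps N\<close>.\<close>

lemma eventually_poly_times_exp_le:
  fixes a j p q :: nat and c c' :: real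
  assumes "0 \<le> c" "c < c'"
  shows "\<forall>\<^sub>F N in at_top. real (a * (p * (2 * N + 2) ^ q) ^ j) *
    2 powr (c * real (steps N) * log 2 (real (steps N))) \<le> 2 powr (c' * real N)"
proof -
  define \<delta> where "\<delta> = (c' - c) / 2"
  \<comment> \<open>Chosen so that \<open>c * \<rho>\<close> is at most \<open>c + \<delta>\<close>;
    the denominator \<open>c + 1\<close> also covers \<open>c = 0\<close>.\<close>
  define \<rho> where "\<rho> = 1 + \<delta> / (c + 1)"
  have \<delta>: "0 < \<delta>" using assms by (simp add: \<delta>_def)
  then have "1 < \<rho>" using assms by (simp add: \<rho>_def)
  have "c / (c + 1) \<le> 1" using assms by simp
  then have "\<delta> * (c / (c + 1)) \<le> \<delta> * 1" using \<delta> by (intro mult_left_mono) auto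
  then have c\<rho>: "c * \<rho> \<le> c + \<delta>" by (simp add: \<rho>_def algebra_simps)
  \<comment> \<open>The added 1 keeps \<open>A\<close> positive, so that it can be written as a
    power of 2.\<close>
  define A where "A = real (a * p ^ j) + 1"
  define n where "n = q * j"
  have "\<forall>\<^sub>F N in at_top. log 2 A + real n * log 2 (2 * real N + 2) \<le> \<delta> * real N"
    using \<delta> by real_asymp
  moreover note eventually_steps_log_steps_le[OF \<open>1 < \<rho>\<close>]
  ultimately show ?thesis
  proof eventually_elim
    case (elim N)
    have "real (a * (p * (2 * N + 2) ^ q) ^ j) = real (a * p ^ j) * (2 * real N + 2) ^ n"
      by (simp add: n_def power_mult_distrib power_mult add.commute)
    also have "\<dots> \<le> A * (2 * real N + 2) ^ n" unfolding A_def by (intro mult_right_mono) auto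
    also have "\<dots> = 2 powr (log 2 A + real n * log 2 (2 * real N + 2))"
    proof -
      have "2 powr (real n * log 2 (2 * real N + 2)) = (2 * real N + 2) ^ n"
        by (simp add: powr_realpow flip: log_powr)
      moreover have "0 < A" unfolding A_def by (simp add: add_nonneg_pos)
      ultimately show ?thesis by (simp add: powr_add)
    qed
    also have "\<dots> \<le> 2 powr (\<delta> * real N)" using elim(1) by simp
    finally have poly: "real (a * (p * (2 * N + 2) ^ q) ^ j) \<le> 2 powr (\<delta> * real N)" .
    have "c * (real (steps N) * log 2 (real (steps N))) \<le> c * (\<rho> * real N)"
      using elim(2) assms(1) by (rule mult_left_mono)
    also have "\<dots> \<le> (c + \<delta>) * real N" using mult_right_mono[OF c\<rho>, of "real N"] by simp
    finally have "2 powr (c * real (steps N) * log 2 (real (steps N))) \<le> 2 powr ((c + \<delta>) * real N)"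
      by (simp add: mult.assoc)
    with poly have "real (a * (p * (2 * N + 2) ^ q) ^ j) *
        2 powr (c * real (steps N) * log 2 (real (steps N))) \<le>
        2 powr (\<delta> * real N) * 2 powr ((c + \<delta>) * real N)" by (intro mult_mono) auto
    also have "\<dots> = 2 powr (c' * real N)"
      by (simp add: \<delta>_def field_simps flip: powr_add)
    finally show ?case .
  qed
qed

text \<open>\<open>tsat_solvable\<close> demands a bound for every \<open>N\<close>. Its constant
  pays for the finitely many exceptions: the 1 in \<open>K\<close> serves the large
  \<open>N\<close>, the sum of ratios each small one.\<close>

lemma eventually_le_imp_bounded:
  fixes F G :: "nat \<Rightarrow> real"
  assumes "\<forall>\<^sub>F N in at_top. F N \<le> G N" "\<And>N. 0 < G N"
  shows "\<exists>K. \<forall>N. F N \<le> K * G N"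
proof -
  obtain M where M: "\<And>N. M \<le> N \<Longrightarrow> F N \<le> G N"
    using assms(1) unfolding eventually_at_top_linorder by blast
  define K where "K = 1 + (\<Sum>N<M. \<bar>F N\<bar> / G N)"
  have pos: "0 \<le> \<bar>F N\<bar> / G N" for N using assms(2)[of N] by simp
  have "F N \<le> K * G N" for N
  proof (cases "N < M")
    case True
    have "\<bar>F N\<bar> / G N \<le> (\<Sum>N<M. \<bar>F N\<bar> / G N)"
      by (rule member_le_sum) (use True pos in auto)
    then have "\<bar>F N\<bar> / G N \<le> K" unfolding K_def by simp
    then show ?thesis using assms(2)[of N] by (simp add: field_simps)
  next
    case False
    have "1 * G N \<le> K * G N"
      unfolding K_def using assms(2)[of N] pos by (intro mult_right_mono) (auto intro: sum_nonneg)
    then show ?thesis using M[of N] False by simp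
  qed
  then show ?thesis by blast
qed

lemma volume_le:
  assumes "is_tcnf t N \<phi>"
  shows "volume N \<phi> \<le> (t + 4) * (2 * N + 2) ^ (t + 1)"
proof -
  let ?b = "fst (blocks N)" and ?r = "snd (blocks N)"
  have r: "?r \<le> N + 2"
  proof (cases "?b = 1")
    case True
    then show ?thesis by (simp add: blocks_facts(1))
  next
    case False
    have "?r * 1 * 1 \<le> ?r * ?b * ?b" using blocks_facts(2)[of N] by (intro mult_le_mono) auto
    then show ?thesis using False blocks_facts(3)[of N] by linarith
  qed
  define X where "X = (2 * N + 2) ^ (t + 1)"
  have "(2 * N + 1) ^ t \<le> (2 * N + 2) ^ t" by (intro power_mono) auto
  also have "\<dots> \<le> X" unfolding X_def by (intro power_increasing) auto
  finally have "(t + 1) * (2 * N + 1) ^ t \<le> (t + 1) * X" by (rule mult_le_mono2)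
  then have len: "length \<phi> \<le> (t + 1) * X" using length_tcnf_le[OF assms] by (rule order_trans[rotated])
  have "(2 * N + 2) ^ 1 \<le> X" unfolding X_def by (intro power_increasing) auto
  then have X: "2 * N + 2 \<le> X" by simp
  have "?r + (?r + Suc q) + 1 \<le> 3 * X" if "q \<le> N" for q
    using r that X by linarith
  from this[OF div_le_dividend] have "?r + steps N + 1 \<le> 3 * X" .
  with len have "volume N \<phi> \<le> 3 * X + (t + 1) * X" unfolding volume_def by simp
  then show ?thesis unfolding X_def by (simp add: algebra_simps)
qed

section \<open>Assembling the algorithm for satisfiability\<close>

lemma decides_within_mono: "decides_within P x c B \<Longrightarrow> B \<le> B' \<Longrightarrow> decides_within P x c B'"
  unfolding decides_within_def halts_within_def by (meson order_trans)

lemma solves_ui_wsp_in_Ostar_mono: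
  assumes "solves_ui_wsp_in_Ostar A f" "\<And>k. f k \<le> g k"
  shows "solves_ui_wsp_in_Ostar A g"
  unfolding solves_ui_wsp_in_Ostar_def
proof
  fix d
  obtain e where e: "\<And>I. valid_input I \<and> poly_checkable d I \<and>
     (\<forall>c\<in>Constraints (workflow_of I). user_independent (Users (workflow_of I)) c) \<Longrightarrow>
     decides_within A (enc_input I) (wsp_satisfiable (workflow_of I))
       (real (poly_bound e I) * f (num_steps I))"
    using assms(1) unfolding solves_ui_wsp_in_Ostar_def by blast
  have "real (poly_bound e I) * f (num_steps I) \<le> real (poly_bound e I) * g (num_steps I)" for I
    using assms(2) by (intro mult_left_mono) auto
  with e show "\<exists>e. \<forall>I. valid_input I \<and> poly_checkable d I \<and>
     (\<forall>c\<in>Constraints (workflow_of I). user_independent (Users (workflow_of I)) c) \<longrightarrow>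
     decides_within A (enc_input I) (wsp_satisfiable (workflow_of I))
       (real (poly_bound e I) * g (num_steps I))"
    by (intro exI[of _ e] allI impI) (rule decides_within_mono)
qed

lemma obtain_checker:
  obtains Q D where "\<And>xs :: nat list. accepts Q (enc xs) \<longleftrightarrow> has_equal_pair xs"
    "\<And>xs :: nat list. halts_within Q (enc xs) (real ((esize xs + 2) ^ D))"
proof -
  obtain Q T where T: "pbounded T"
    "\<And>xs :: nat list. \<exists>t \<le> T xs. exec Q (init_state (enc xs)) t (init_state (enc (has_equal_pair xs)))"
    by (rule ptimeE[OF ptime_has_equal_pair], rule that)
  obtain D :: nat where D: "\<And>xs. T xs \<le> (esize xs + 2) ^ D" using T(1) unfolding pbounded_def by blast
  show thesis
  proof
    fix xs :: "nat list"
    obtain t where t: "t \<le> T xs" "exec Q (init_state (enc xs)) t (init_state (enc (has_equal_pair xs)))"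
      using T(2) by blast
    have "accepts Q (enc xs) \<longleftrightarrow> init_state (enc (has_equal_pair xs)) 0 \<noteq> Leaf"
      unfolding accepts_def using t(2) exec_deterministic by blast
    then show "accepts Q (enc xs) \<longleftrightarrow> has_equal_pair xs"
      by (cases "has_equal_pair xs") (auto simp: init_state_def)
    have "t \<le> (esize xs + 2) ^ D" using t(1) D[of xs] by linarith
    then show "halts_within Q (enc xs) (real ((esize xs + 2) ^ D))"
      unfolding halts_within_def using t(2) of_nat_mono by blast
  qed
qed

lemma obtain_reducer:
  obtains R D where "\<And>N \<phi>. size (enc_input (reduction Q N \<phi>)) \<le> (esize (N, \<phi>) + 2) ^ D"
    "\<And>N \<phi>. \<exists>u \<le> (esize (N, \<phi>) + 2) ^ D.
      exec R (init_state (enc_cnf N \<phi>)) u (init_state (enc_input (reduction Q N \<phi>)))"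
proof -
  obtain R T where T: "pbounded T"
    "\<And>x. \<exists>u \<le> T x. exec R (init_state (enc x)) u
      (init_state (enc_input (reduction Q (fst x) (snd x))))"
    by (rule ptimeE[OF ptime_reduction, folded enc_input_eq], rule that)
  note S = ptime_esize[OF ptime_reduction[of Q], folded enc_input_eq]
  obtain D where D: "\<And>x. T x + size (enc_input (reduction Q (fst x) (snd x))) \<le> (esize x + 2) ^ D"
    using pbounded_add[OF T(1) S] unfolding pbounded_def by blast
  show thesis
  proof
    fix N \<phi>
    show "size (enc_input (reduction Q N \<phi>)) \<le> (esize (N, \<phi>) + 2) ^ D"
      using D[of "(N, \<phi>)"] unfolding fst_conv snd_conv by linarith
    have "T (N, \<phi>) \<le> (esize (N, \<phi>) + 2) ^ D"
      using D[of "(N, \<phi>)"] by linarith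
    then show "\<exists>u \<le> (esize (N, \<phi>) + 2) ^ D.
        exec R (init_state (enc_cnf N \<phi>)) u (init_state (enc_input (reduction Q N \<phi>)))"
      using T(2)[of "(N, \<phi>)"] unfolding enc_cnf_eq fst_conv snd_conv by (meson order_trans)
  qed
qed

lemma tsat_solvable_if_ui_wsp_solvable:
  assumes A: "solves_ui_wsp_in_Ostar A (\<lambda>k. 2 powr (c * real k * log 2 (real k)))"
    and c: "0 \<le> c" "c < c'"
  shows "tsat_solvable t c'"
proof -
  obtain Q D' where Q: "\<And>xs :: nat list. accepts Q (enc xs) \<longleftrightarrow> has_equal_pair xs"
    "\<And>xs :: nat list. halts_within Q (enc xs) (real ((esize xs + 2) ^ D'))"
    by (rule obtain_checker, rule that)
  obtain R D where size: "\<And>N \<phi>. size (enc_input (reduction Q N \<phi>)) \<le> (esize (N, \<phi>) + 2) ^ D"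
    and R: "\<And>N \<phi>. \<exists>u \<le> (esize (N, \<phi>) + 2) ^ D.
      exec R (init_state (enc_cnf N \<phi>)) u (init_state (enc_input (reduction Q N \<phi>)))"
    by (rule obtain_reducer, rule that)
  obtain d where d: "\<And>N \<phi>. is_tcnf t N \<phi> \<Longrightarrow> poly_checkable d (reduction Q N \<phi>)"
    using poly_checkable_reduction[OF size Q(2), of t] by blast
  \<comment> \<open>\<open>d\<close> is the same for all \<open>N\<close> and \<open>\<phi>\<close>,
    so one \<open>e\<close> serves all formulas with clauses of length at most
    \<open>t\<close>.\<close>
  obtain e where e: "\<And>I. valid_input I \<and> poly_checkable d I \<and>
     (\<forall>c\<in>Constraints (workflow_of I). user_independent (Users (workflow_of I)) c) \<Longrightarrow>
     decides_within A (enc_input I) (wsp_satisfiable (workflow_of I))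
       (real (poly_bound e I) * 2 powr (c * real (num_steps I) * log 2 (real (num_steps I))))"
    using A unfolding solves_ui_wsp_in_Ostar_def by blast
  \<comment> \<open>\<open>a\<close> and \<open>j\<close> dominate the coefficients and exponents of
    the time bounds for the reduction and for the call of \<open>A\<close> together.\<close>
  define a where "a = (3 * t + 6) ^ D + e"
  define j where "j = 3 * D + e"
  define x where "x N = c * real (steps N) * log 2 (real (steps N))" for N
  \<comment> \<open>Allows the time of the reduction to be multiplied by the exponential factor too,
    so that both terms get the same shape.\<close>
  have x: "1 \<le> 2 powr x N" for N
    unfolding x_def using c(1) by (intro ge_one_powr_ge_zero mult_nonneg_nonneg) auto
  obtain K where K: "\<And>N. real (a * ((t + 4) * (2 * N + 2) ^ (t + 1)) ^ j) * 2 powr x N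
      \<le> K * 2 powr (c' * real N)"
    using eventually_le_imp_bounded[OF eventually_poly_times_exp_le[OF c, of a "t + 4" "t + 1" j]]
    unfolding x_def by auto
  have "decides_within (Seq R A) (enc_cnf N \<phi>) (cnf_satisfiable \<phi>) (K * 2 powr (c' * real N))"
    if \<phi>: "is_tcnf t N \<phi>" for N \<phi>
  proof -
    let ?I = "reduction Q N \<phi>" and ?V = "volume N \<phi>"
    have V: "1 \<le> ?V" by (simp add: volume_def)
    have dec: "decides_within A (enc_input ?I) (cnf_satisfiable \<phi>)
        (real (poly_bound e ?I) * 2 powr x N)"
      using e[of ?I] d[OF \<phi>] valid_input_reduction[OF Q(1) \<phi>]
        user_independent_reduction[OF Q(1) \<phi>] wsp_satisfiable_reduction[OF Q(1) \<phi>]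
      by (simp add: reduction_simps x_def)
    obtain u where u: "u \<le> (esize (N, \<phi>) + 2) ^ D"
      "exec R (init_state (enc_cnf N \<phi>)) u (init_state (enc_input ?I))"
      using R by blast
    have "u \<le> ((3 * t + 6) * ?V ^ 3) ^ D"
      using u(1) power_mono[OF esize_le_volume[OF \<phi>], of D] by linarith
    also have "\<dots> = (3 * t + 6) ^ D * ?V ^ (3 * D)"
      by (simp add: power_mult_distrib power_mult)
    also have "\<dots> \<le> (3 * t + 6) ^ D * ?V ^ j"
      using V by (intro mult_le_mono2 power_increasing) (auto simp: j_def)
    finally have u': "u \<le> (3 * t + 6) ^ D * ?V ^ j" .
    have e': "poly_bound e ?I \<le> e * ?V ^ j"
      unfolding poly_bound_reduction using V
      by (intro mult_le_mono2 power_increasing) (auto simp: j_def)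
    have "real u + real (poly_bound e ?I) * 2 powr x N \<le>
        real ((3 * t + 6) ^ D * ?V ^ j) * 2 powr x N + real (e * ?V ^ j) * 2 powr x N"
    proof (rule add_mono)
      have "real u * 1 \<le> real ((3 * t + 6) ^ D * ?V ^ j) * 2 powr x N"
        using x[of N] of_nat_mono[OF u'] by (intro mult_mono) auto
      then show "real u \<le> real ((3 * t + 6) ^ D * ?V ^ j) * 2 powr x N" by simp
      show "real (poly_bound e ?I) * 2 powr x N \<le> real (e * ?V ^ j) * 2 powr x N"
        using of_nat_mono[OF e'] by (intro mult_right_mono) auto
    qed
    also have "\<dots> = real (a * ?V ^ j) * 2 powr x N"
      by (simp add: a_def algebra_simps)
    also have "\<dots> \<le> real (a * ((t + 4) * (2 * N + 2) ^ (t + 1)) ^ j) * 2 powr x N"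
      using power_mono[OF volume_le[OF \<phi>], of j]
      by (intro mult_right_mono of_nat_mono mult_le_mono2) auto
    also note K
    finally show ?thesis
      using decides_within_mono[OF decides_within_Seq[OF u(2) dec]] by blast
  qed
  then show ?thesis unfolding tsat_solvable_def by blast
qed

theorem mainTheorem4:
  assumes "SETH"
  shows "\<not> (\<exists>c::real. c < 1 \<and>
    (\<exists>A. solves_ui_wsp_in_Ostar A (\<lambda>k. 2 powr (c * real k * log 2 (real k)))))"
proof
  assume "\<exists>c::real. c < 1 \<and>
    (\<exists>A. solves_ui_wsp_in_Ostar A (\<lambda>k. 2 powr (c * real k * log 2 (real k))))"
  then obtain c A where c: "c < 1"
    and A: "solves_ui_wsp_in_Ostar A (\<lambda>k. 2 powr (c * real k * log 2 (real k)))"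
    by blast
  \<comment> \<open>A negative exponent is raised to 0, as
    \<open>tsat_solvable_if_ui_wsp_solvable\<close> needs. \<open>c1\<close> lies strictly between
    \<open>c0\<close> and 1, which leaves room for polynomial factors.\<close>
  define c0 where "c0 = max c 0"
  define c1 where "c1 = (c0 + 1) / 2"
  have c01: "0 \<le> c0" "c0 < c1" "c1 < 1" using c by (auto simp: c0_def c1_def)
  have "c * real k * log 2 (real k) \<le> c0 * real k * log 2 (real k)" for k
  proof (cases "k = 0")
    case False
    then have "0 \<le> real k * log 2 (real k)" by simp
    then have "c * (real k * log 2 (real k)) \<le> c0 * (real k * log 2 (real k))"
      by (intro mult_right_mono) (auto simp: c0_def)
    then show ?thesis by (simp add: mult.assoc)
  qed simp
  then have "solves_ui_wsp_in_Ostar A (\<lambda>k. 2 powr (c0 * real k * log 2 (real k)))"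
    by (intro solves_ui_wsp_in_Ostar_mono[OF A]) simp
  then have "tsat_solvable t c1" for t
    using c01 by (intro tsat_solvable_if_ui_wsp_solvable)
  then have "Inf {c. c \<ge> 0 \<and> tsat_solvable t c} \<le> c1" for t
    using c01 by (intro cInf_lower bdd_belowI[of _ 0]) auto
  \<comment> \<open>\<open>c1\<close> is the same for every \<open>t\<close>, so it bounds the limit
    1 in \<open>SETH\<close>.\<close>
  then have "1 \<le> c1"
    using assms unfolding SETH_def by (intro LIMSEQ_le_const2) auto
  then show False using c01 by simp
qed

end
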